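(* Let $R$ be a reduced irreducible root system with set of simple roots $\Delta$, and let $\alpha\in\Delta$. Then the sequence $\{d_k(\alpha)\}_{1\le k\le h_\alpha}$ has the circular symmetry property with respect to $N=h_\alpha$ and $M=gh_\alpha/g_\alpha$; that is, for all consecutive terms $a/x$ and $b/y$ of the Farey sequence $\mathcal{F}_{h_\alpha}$ (written in lowest terms), $$d_x(\alpha)+d_y(\alpha)=\frac{2gh_\alpha}{g_\alpha\,xy}.$$
   Context: Let $\widetilde\alpha=\sum_{\beta\in\Delta}h_\beta\beta$ be the highest root and $\widetilde\alpha^\vee=\sum_{\beta\in\Delta}g_\beta\beta^\vee$ its coroot; $g=1+\sum_{\beta\in\Delta}g_\beta$ is the dual Coxeter number. $\varpi_\alpha$ and $\varpi_\alpha^\vee$ are the fundamental weight and fundamental coweight of $\alpha$. For $k>0$, $c(\alpha,k)$ is the number of roots $\beta\in R$ with $\beta(\varpi_\alpha^\vee)=k$ (the coefficient of $\alpha$ in $\beta$ is $k$), $i(\alpha,k)=kc(\alpha,k)/\varpi_\alpha(\varpi_\alpha^\vee)$, and $d_k(\alpha)=\sum_{\ell>0}i(\alpha,\ell k)$. These are positive integers for $1\le k\le h_\alpha$, and $\sum_{k>0}\varphi(k)d_k(\alpha)=gh_\alpha/g_\alpha$ with $\varphi$ Euler's function. The Farey sequence $\mathcal{F}_N=\{0/1,1/N,1/(N-1),\dots,1/1\}$ is the increasing sequence of rational numbers in $[0,1]$, written in lowest terms, whose denominator is at most $N$. A sequence $d_1,\dots,d_N$ of positive integers with $M=\sum_{k>0}\varphi(k)d_k$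 has the circular symmetry property with respect to $N$ and $M$ if $d_x+d_y=2M/(xy)$ for all consecutive terms $r/x$, $s/y$ in $\mathcal{F}_N$. *)

theory Defs
  imports "HOL-Analysis.Analysis" "HOL-Number_Theory.Totient"
begin

(* Roots live in a Euclidean space V whose inner product is used to identify V with its dual:
   a linear form f on V is represented by the vector v with f x = x \<bullet> v. Thus coroots and
   fundamental coweights are vectors of V as well, and evaluation is the inner product. *)

definition coroot :: "'a::euclidean_space \<Rightarrow> 'a"
  where "coroot \<alpha> = (2 / (\<alpha> \<bullet> \<alpha>)) *\<^sub>R \<alpha>"

definition root_system :: "'a::euclidean_space set \<Rightarrow> bool"
  where "root_system R \<longleftrightarrow>
    finite R \<and> 0 \<notin> R \<and> span R = UNIV \<and>
    (\<forall>\<alpha>\<in>R. \<forall>\<beta>\<in>R. \<beta> - (\<beta> \<bullet> coroot \<alpha>) *\<^sub>R \<alpha> \<in> R) \<and>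
    (\<forall>\<alpha>\<in>R. \<forall>\<beta>\<in>R. \<beta> \<bullet> coroot \<alpha> \<in> \<int>)"

definition reduced_roots :: "'a::euclidean_space set \<Rightarrow> bool"
  where "reduced_roots R \<longleftrightarrow> (\<forall>\<alpha>\<in>R. \<forall>c::real. c *\<^sub>R \<alpha> \<in> R \<longrightarrow> c = 1 \<or> c = - 1)"

definition irreducible_roots :: "'a::euclidean_space set \<Rightarrow> bool"
  where "irreducible_roots R \<longleftrightarrow>
    R \<noteq> {} \<and>
    \<not> (\<exists>A B. R = A \<union> B \<and> A \<noteq> {} \<and> B \<noteq> {} \<and> (\<forall>\<alpha>\<in>A. \<forall>\<beta>\<in>B. \<alpha> \<bullet> \<beta> = 0))"

definition simple_roots :: "'a::euclidean_space set \<Rightarrow> 'a set \<Rightarrow> bool"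
  where "simple_roots R \<Delta> \<longleftrightarrow>
    \<Delta> \<subseteq> R \<and> independent \<Delta> \<and>
    (\<forall>\<beta>\<in>R. \<exists>n :: 'a \<Rightarrow> nat.
       \<beta> = (\<Sum>\<alpha>\<in>\<Delta>. real (n \<alpha>) *\<^sub>R \<alpha>) \<or> \<beta> = - (\<Sum>\<alpha>\<in>\<Delta>. real (n \<alpha>) *\<^sub>R \<alpha>))"

(* For a reduced irreducible root system the root described here exists and is unique. *)
definition highest_root :: "'a::euclidean_space set \<Rightarrow> 'a set \<Rightarrow> 'a"
  where "highest_root R \<Delta> =
    (THE \<theta>. \<theta> \<in> R \<and> (\<forall>\<beta>\<in>R. \<forall>\<alpha>\<in>\<Delta>. representation \<Delta> \<beta> \<alpha> \<le> representation \<Delta> \<theta> \<alpha>))"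

definition h_coeff :: "'a::euclidean_space set \<Rightarrow> 'a set \<Rightarrow> 'a \<Rightarrow> real"
  where "h_coeff R \<Delta> \<alpha> = representation \<Delta> (highest_root R \<Delta>) \<alpha>"

definition g_coeff :: "'a::euclidean_space set \<Rightarrow> 'a set \<Rightarrow> 'a \<Rightarrow> real"
  where "g_coeff R \<Delta> \<alpha> = representation (coroot ` \<Delta>) (coroot (highest_root R \<Delta>)) (coroot \<alpha>)"

definition dual_coxeter_number :: "'a::euclidean_space set \<Rightarrow> 'a set \<Rightarrow> real"
  where "dual_coxeter_number R \<Delta> = 1 + (\<Sum>\<beta>\<in>\<Delta>. g_coeff R \<Delta> \<beta>)"

(* The fundamental weights form the dual basis of the simple coroots, the fundamental coweights
   that of the simple roots. *)
definition fund_weight :: "'a::euclidean_space set \<Rightarrow> 'a \<Rightarrow> 'a"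
  where "fund_weight \<Delta> \<alpha> = (THE w. \<forall>\<beta>\<in>\<Delta>. w \<bullet> coroot \<beta> = (if \<beta> = \<alpha> then 1 else 0))"

definition fund_coweight :: "'a::euclidean_space set \<Rightarrow> 'a \<Rightarrow> 'a"
  where "fund_coweight \<Delta> \<alpha> = (THE v. \<forall>\<beta>\<in>\<Delta>. \<beta> \<bullet> v = (if \<beta> = \<alpha> then 1 else 0))"

definition c_count :: "'a::euclidean_space set \<Rightarrow> 'a set \<Rightarrow> 'a \<Rightarrow> nat \<Rightarrow> nat"
  where "c_count R \<Delta> \<alpha> k = card {\<beta> \<in> R. \<beta> \<bullet> fund_coweight \<Delta> \<alpha> = real k}"

definition i_num :: "'a::euclidean_space set \<Rightarrow> 'a set \<Rightarrow> 'a \<Rightarrow> nat \<Rightarrow> real"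
  where "i_num R \<Delta> \<alpha> k =
    real k * real (c_count R \<Delta> \<alpha> k) / (fund_weight \<Delta> \<alpha> \<bullet> fund_coweight \<Delta> \<alpha>)"

(* For k > 0 only finitely many summands are nonzero. *)
definition d_num :: "'a::euclidean_space set \<Rightarrow> 'a set \<Rightarrow> 'a \<Rightarrow> nat \<Rightarrow> real"
  where "d_num R \<Delta> \<alpha> k = (\<Sum>\<^sub>\<infinity>l\<in>{1..}. i_num R \<Delta> \<alpha> (l * k))"

(* quotient_of yields the representation in lowest terms with positive denominator. *)
definition denom :: "rat \<Rightarrow> nat"
  where "denom q = nat (snd (quotient_of q))"

definition farey :: "nat \<Rightarrow> rat set"
  where "farey N = {q. 0 \<le> q \<and> q \<le> 1 \<and> denom q \<le> N}"

definition farey_consecutive :: "nat \<Rightarrow> rat \<Rightarrow> rat \<Rightarrow> bool"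
  where "farey_consecutive N q r \<longleftrightarrow>
    q \<in> farey N \<and> r \<in> farey N \<and> q < r \<and> \<not> (\<exists>t\<in>farey N. q < t \<and> t < r)"

(* Only the entries d 1, ..., d N of the function d matter. *)
definition circular_symmetry :: "nat \<Rightarrow> real \<Rightarrow> (nat \<Rightarrow> real) \<Rightarrow> bool"
  where "circular_symmetry N M d \<longleftrightarrow>
    (\<forall>k\<in>{1..N}. d k \<in> \<int> \<and> d k > 0) \<and>
    M = (\<Sum>k=1..N. real (totient k) * d k) \<and>
    (\<forall>q r. farey_consecutive N q r \<longrightarrow>
       d (denom q) + d (denom r) = 2 * M / (real (denom q) * real (denom r)))"

end

(* Let v be the fundamental coweight of alpha. For t = a/x with x <= h_alpha, the vector
   xi = (sum of saw(t beta(v)) beta over all roots beta), with saw the odd sawtooth function, is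
   fixed by the reflection in every root gamma with t gamma(v) an integer, as saw has period 1.
   These gamma span: they include the simple roots other than alpha and a root of level x. Hence
   xi = 0. Between Farey neighbours a/x < b/y no product m t with m <= h_alpha crosses an
   integer, so comparing xi(v) at both ends gives the sum of m^2 c(alpha, m) / (xy) on one side
   and half the sums of m c(alpha, m) over x | m and y | m on the other. The former sum is
   evaluated with the invariant form (sum of beta(.) beta(.) over all roots), a multiple of the
   inner product by irreducibility; evaluating it at the coroot of the highest root gives the
   dual Coxeter number. *)

theory Submission
  imports Defs
begin

section \<open>The sawtooth function and Farey neighbours\<close>

text \<open>The sum over m of \<open>m c(\<alpha>, m) saw(m t)\<close> shows no symmetry of its own.
  Read as the pairing of v with a vector it does: a vector is orthogonal to every root whose
  reflection fixes it. \<open>saw\<close> is the sawtooth of Dedekind sums: the fractional part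
  minus 1/2, but 0 at integers. This midpoint value matters twice. It makes \<open>saw\<close> odd
  everywhere, so that opposite roots contribute equally; and it puts half of each jump on either
  side of an integer, so that a multiple m of x (or of y) contributes exactly one half at a/x (or at
  b/y). Hence d_x + d_y, and the factor 2 in 2M/(xy). The division by the pairing of fundamental
  weight and coweight makes the terms integers. It also cancels the squared length of v in the value
  of the invariant form; what remains is the squared length of the highest root over that of
  \<alpha>, which is the quotient of the coefficients h and g at \<alpha>. Long and short \<alpha>
  are thus treated alike, with no classification.\<close>

definition saw :: "real \<Rightarrow> real"
  where "saw z = z - (of_int \<lfloor>z\<rfloor> + of_int \<lceil>z\<rceil>) / 2"

lemma saw_minus: "saw (- z) = - saw z"
  by (simp add: saw_def ceiling_def field_simps)

lemma saw_add_int: "k \<in> \<int> \<Longrightarrow> saw (z + k) = saw z"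
  by (auto simp: saw_def field_simps elim!: Ints_cases)

lemma saw_diff_int: "k \<in> \<int> \<Longrightarrow> saw (z - k) = saw z"
  using saw_add_int[of "- k" z] by simp

text \<open>Between integers \<open>saw\<close> has slope 1. At an integer endpoint its value 0
  differs by 1/2 from the one-sided limit, 1/2 from the left and -1/2 from the right; both
  deviations lower the difference.\<close>

lemma saw_diff_no_integer_between:
  assumes "z < w" and none: "\<And>k::int. z < of_int k \<Longrightarrow> of_int k < w \<Longrightarrow> False"
  shows "saw w - saw z = w - z - (of_bool (w \<in> \<int>) + of_bool (z \<in> \<int>)) / 2"
proof -
  have "\<lceil>w\<rceil> = \<lfloor>z\<rfloor> + 1"
  proof (rule antisym)
    have "w \<le> of_int (\<lfloor>z\<rfloor> + 1)"
      using none[of "\<lfloor>z\<rfloor> + 1"] floor_correct[of z] not_less by blast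
    then show "\<lceil>w\<rceil> \<le> \<lfloor>z\<rfloor> + 1"
      by (simp add: ceiling_le_iff)
    show "\<lfloor>z\<rfloor> + 1 \<le> \<lceil>w\<rceil>"
      using assms(1) by linarith
  qed
  then have "real_of_int \<lceil>w\<rceil> = of_int \<lfloor>z\<rfloor> + 1"
    by simp
  moreover have ceil: "real_of_int \<lceil>u\<rceil> = of_int \<lfloor>u\<rfloor> + 1 - of_bool (u \<in> \<int>)" for u :: real
    by (auto simp: ceiling_altdef Ints_def)
  ultimately show ?thesis
    using ceil[of z] ceil[of w] unfolding saw_def by (simp add: diff_divide_distrib add_divide_distrib)
qed

section \<open>Farey fractions and their neighbours\<close>

lemma farey_fraction:
  obtains a where "q = of_int a / of_nat (denom q)" "denom q > 0" "coprime a (int (denom q))"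
proof -
  obtain a b where ab: "quotient_of q = (a, b)"
    by fastforce
  have "b > 0" "coprime a b" "q = of_int a / of_int b"
    using ab quotient_of_denom_pos quotient_of_coprime quotient_of_div by blast+
  moreover have "int (denom q) = b"
    using ab \<open>b > 0\<close> by (simp add: denom_def)
  ultimately show thesis
    using that[of a] by (metis of_int_of_nat_eq of_nat_0_less_iff)
qed

text \<open>Cancelling only shrinks a denominator. The fraction may be unreduced, so that membership
  in \<open>farey N\<close> can be checked without computing lowest terms.\<close>

lemma denom_le:
  fixes a b :: int
  assumes "b > 0"
  shows "denom (of_int a / of_int b) \<le> nat b"
proof -
  obtain p where p: "(of_int a / of_int b :: rat) = of_int p / of_nat (denom (of_int a / of_int b))"
      "denom (of_int a / of_int b) > 0" "coprime p (int (denom (of_int a / of_int b)))"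
    by (rule farey_fraction)
  define d where "d = denom (of_int a / of_int b)"
  have "rat_of_int a / of_int b = of_int p / of_int (int d)" "d > 0" "coprime p (int d)"
    using p by (simp_all add: d_def)
  then have "rat_of_int (a * int d) = of_int (p * b)"
    using assms by (simp add: field_simps)
  then have "int d dvd p * b"
    by (metis of_int_eq_iff dvd_triv_right)
  then have "int d dvd b"
    using \<open>coprime p (int d)\<close> by (simp add: coprime_dvd_mult_right_iff coprime_commute)
  then have "int d \<le> b"
    using assms by (simp add: zdvd_imp_le)
  then show ?thesis
    by (simp add: d_def)
qed

lemma fareyI:
  fixes a b :: int
  assumes "0 < b" "b \<le> int N" "0 \<le> a" "a \<le> b"
  shows "of_int a / of_int b \<in> farey N"
  using assms denom_le[of b a] by (auto simp: farey_def)

text \<open>The claim amounts to b x - a y = 1 for q = a/x and r = b/y. Bezout coefficients give a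
  fraction of \<open>farey N\<close> that has determinant 1 with q, and this fraction turns out to
  be r itself.\<close>

lemma farey_consecutive_diff:
  assumes "farey_consecutive N q r"
  shows "r - q = 1 / (of_nat (denom q) * of_nat (denom r))"
proof -
  obtain a where a: "q = of_int a / of_nat (denom q)" "denom q > 0" "coprime a (int (denom q))"
    by (rule farey_fraction)
  obtain b where b: "r = of_int b / of_nat (denom r)" "denom r > 0" "coprime b (int (denom r))"
    by (rule farey_fraction)
  define x y where "x = int (denom q)" and "y = int (denom r)"
  have q: "q = of_int a / of_int x" and r: "r = of_int b / of_int y"
    using a b by (simp_all add: x_def y_def)
  have pos: "x > 0" "y > 0"
    using a b by (simp_all add: x_def y_def)
  have le: "x \<le> int N" "y \<le> int N" and "0 \<le> q" "q < r" "r \<le> 1"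
    and cons: "\<And>t. t \<in> farey N \<Longrightarrow> q < t \<Longrightarrow> t < r \<Longrightarrow> False"
    using assms by (auto simp: farey_consecutive_def farey_def x_def y_def)
  have "0 \<le> a"
    using \<open>0 \<le> q\<close> pos by (simp add: q zero_le_divide_iff)
  have "a < x"
    using less_le_trans[OF \<open>q < r\<close> \<open>r \<le> 1\<close>] pos by (simp add: q)
  have lt: "a * y < b * x"
    using \<open>q < r\<close> pos by (simp add: q r field_simps flip: of_int_mult)
  obtain u0 v0 where uv0: "u0 * x + v0 * a = 1"
    using bezout_int[of x a] a(3) by (auto simp: x_def coprime_iff_gcd_eq_1 gcd.commute)
  \<comment> \<open>The successor of \<open>a / x\<close> is \<open>u / w\<close>, where \<open>u x - a w = 1\<close> and \<open>N - x < w \<le> N\<close>.\<close>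
  define k where "k = (int N + v0) div x"
  define w u where "w = - v0 + k * x" and "u = u0 + k * a"
  have uw: "u * x - a * w = 1"
    using uv0 by (simp add: u_def w_def algebra_simps)
  have "x * k \<le> int N + v0" "int N + v0 < x * k + x"
    using pos(1) unfolding k_def
    by (smt (verit) mult_div_mod_eq pos_mod_bound pos_mod_sign)+
  then have w: "w \<le> int N" "int N < w + x"
    by (simp_all add: w_def algebra_simps)
  have "w > 0"
    using w le by simp
  have "u * x > 0"
    using uw \<open>0 \<le> a\<close> \<open>w > 0\<close> by (smt (verit) mult_nonneg_nonneg)
  then have "u > 0"
    using pos by (simp add: zero_less_mult_iff)
  have "u * x \<le> w * x"
  proof -
    have "a * w \<le> (x - 1) * w"
      using \<open>a < x\<close> \<open>w > 0\<close> by (intro mult_right_mono) auto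
    then show ?thesis
      using uw \<open>w > 0\<close> by (simp add: algebra_simps)
  qed
  then have "u \<le> w"
    using pos by simp
  then have "of_int u / of_int w \<in> farey N"
    using fareyI w \<open>w > 0\<close> \<open>u > 0\<close> by simp
  moreover have "q < of_int u / of_int w"
    using uw pos \<open>w > 0\<close> by (simp add: q field_simps flip: of_int_mult)
  ultimately have "r \<le> of_int u / of_int w"
    using cons by force
  then have uw_ge: "b * w \<le> u * y"
    using pos \<open>w > 0\<close> by (simp add: r field_simps flip: of_int_mult)
  \<comment> \<open>If r were strictly below u/w, both determinants in the identity for y would be
    at least 1, so y would be at least w + x, which exceeds N.\<close>
  have "u * y = b * w"
  proof (rule ccontr)
    assume "u * y \<noteq> b * w"
    then have "x * 1 \<le> x * (u * y - b * w)"
      using uw_ge pos by (intro mult_left_mono) auto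
    moreover have "w * 1 \<le> w * (b * x - a * y)"
      using lt \<open>w > 0\<close> by (intro mult_left_mono) auto
    moreover have "y = w * (b * x - a * y) + x * (u * y - b * w)"
      using uw by algebra
    ultimately show False
      using w le by linarith
  qed
  \<comment> \<open>The determinant divides both y and b, which are coprime, so it is a
    unit.\<close>
  then have y: "y = w * (b * x - a * y)" and b_eq: "b = u * (b * x - a * y)"
    using uw by algebra+
  then have "b * x - a * y dvd y" "b * x - a * y dvd b"
    by (metis dvd_triv_right)+
  then have "is_unit (b * x - a * y)"
    using b(3) by (auto simp: y_def coprime_def)
  then have "b * x - a * y = 1"
    using lt by simp
  then have "rat_of_int b * of_int x - of_int a * of_int y = 1"
    by (metis of_int_1 of_int_diff of_int_mult)
  then have "r - q = 1 / (of_int x * of_int y)"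
    using pos by (simp add: q r field_simps)
  then show ?thesis
    by (simp add: x_def y_def)
qed

section \<open>From vanishing sawtooth sums to circular symmetry\<close>

text \<open>Isolates the arithmetic: the root system enters only through the weights
  \<open>i m\<close>, which must be positive integers with sawtooth sums vanishing at every fraction
  of denominator at most N.\<close>

lemma circular_symmetryI:
  fixes i d :: "nat \<Rightarrow> real"
  assumes int: "\<And>m. m \<in> {1..N} \<Longrightarrow> i m \<in> \<int>"
    and pos: "\<And>m. m \<in> {1..N} \<Longrightarrow> i m > 0"
    and d: "\<And>k. k \<in> {1..N} \<Longrightarrow> d k = (\<Sum>m=1..N. if k dvd m then i m else 0)"
    and M: "M = (\<Sum>m=1..N. real m * i m)"
    and saw: "\<And>(a::int) x. x \<in> {1..N} \<Longrightarrow> (\<Sum>m=1..N. i m * saw (real m * (of_int a / real x))) = 0"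
  shows "circular_symmetry N M d"
  unfolding circular_symmetry_def
proof (intro conjI allI ballI impI)
  fix k assume k: "k \<in> {1..N}"
  show "d k \<in> \<int>"
    unfolding d[OF k] using int by (intro Ints_sum) auto
  have "i k \<le> (\<Sum>m=1..N. if k dvd m then i m else 0)"
    using k pos member_le_sum[of k "{1..N}" "\<lambda>m. if k dvd m then i m else 0"]
    by (auto simp: less_imp_le)
  then show "d k > 0"
    using pos[OF k] d[OF k] by linarith
next
  \<comment> \<open>Exchanging the sums leaves, for each m, the totients of its divisors, whose sum
    is m.\<close>
  have "(\<Sum>k=1..N. real (totient k) * d k) =
      (\<Sum>k=1..N. \<Sum>m=1..N. if k dvd m then real (totient k) * i m else 0)"
    by (simp add: d sum_distrib_left if_distrib cong: if_cong)
  also have "\<dots> = (\<Sum>m=1..N. \<Sum>k=1..N. if k dvd m then real (totient k) * i m else 0)"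
    by (rule sum.swap)
  also have "\<dots> = (\<Sum>m=1..N. real m * i m)"
  proof (rule sum.cong[OF refl])
    fix m assume m: "m \<in> {1..N}"
    have "{k \<in> {1..N}. k dvd m} = {k. k dvd m}"
      using m by (auto dest: dvd_imp_le dvd_pos_nat intro: Suc_leI)
    then have "(\<Sum>k=1..N. if k dvd m then real (totient k) * i m else 0) =
        (\<Sum>k | k dvd m. real (totient k) * i m)"
      by (simp flip: sum.inter_filter)
    also have "\<dots> = real (\<Sum>k | k dvd m. totient k) * i m"
      by (simp add: sum_distrib_right)
    finally show "(\<Sum>k=1..N. if k dvd m then real (totient k) * i m else 0) = real m * i m"
      by (simp only: totient_divisor_sum)
  qed
  finally show "M = (\<Sum>k=1..N. real (totient k) * d k)"
    using M by simp
next
  fix q r assume qr: "farey_consecutive N q r"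
  obtain a where a: "q = of_int a / of_nat (denom q)" "denom q > 0" "coprime a (int (denom q))"
    by (rule farey_fraction)
  obtain b where b: "r = of_int b / of_nat (denom r)" "denom r > 0" "coprime b (int (denom r))"
    by (rule farey_fraction)
  define x y where "x = denom q" and "y = denom r"
  have mem: "q \<in> farey N" "r \<in> farey N" and "q < r"
    and cons: "\<And>t. t \<in> farey N \<Longrightarrow> q < t \<Longrightarrow> t < r \<Longrightarrow> False"
    using qr by (auto simp: farey_consecutive_def)
  have xy: "x \<in> {1..N}" "y \<in> {1..N}" and "0 \<le> q" "r \<le> 1"
    using mem a b by (auto simp: farey_def x_def y_def)
  have real_q: "real_of_rat q = of_int a / real x" and real_r: "real_of_rat r = of_int b / real y"
    by (subst a(1) b(1); simp add: x_def y_def of_rat_divide)+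
  have int_iff: "real m * (of_int c / real z) \<in> \<int> \<longleftrightarrow> z dvd m"
    if "coprime c (int z)" "z > 0" for c :: int and m z :: nat
  proof
    assume "real m * (of_int c / real z) \<in> \<int>"
    then obtain k :: int where "real m * (of_int c / real z) = of_int k"
      by (auto elim: Ints_cases)
    then have "real_of_int (int m * c) = real_of_int (k * int z)"
      using that by (simp add: field_simps)
    then have "int m * c = k * int z"
      by (simp only: of_int_eq_iff)
    then have "int z dvd int m * c"
      by simp
    then show "z dvd m"
      using that by (simp add: coprime_dvd_mult_left_iff coprime_commute)
  qed (use that in auto)
  have step: "saw (real m * of_rat r) - saw (real m * of_rat q) =
      real m / (x * y) - (of_bool (y dvd m) + of_bool (x dvd m)) / 2" if m: "m \<in> {1..N}" for m
  proof -
    have "saw (real m * of_rat r) - saw (real m * of_rat q) = real m * of_rat r - real m * of_rat q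
        - (of_bool (real m * of_rat r \<in> \<int>) + of_bool (real m * of_rat q \<in> \<int>)) / 2"
    proof (rule saw_diff_no_integer_between)
      show "real m * of_rat q < real m * of_rat r"
        using m \<open>q < r\<close> by (simp add: of_rat_less)
      fix k :: int
      assume k: "real m * of_rat q < of_int k" "of_int k < real m * of_rat r"
      have "real_of_rat q < of_rat (of_int k / of_nat m)" "of_rat (of_int k / of_nat m) < real_of_rat r"
        using k m by (simp_all add: of_rat_divide field_simps)
      then have lt: "q < of_int k / of_nat m" "of_int k / of_nat m < r"
        by (simp_all only: of_rat_less)
      have "0 < rat_of_int k / of_nat m" "rat_of_int k / of_nat m < 1"
        using lt \<open>0 \<le> q\<close> \<open>r \<le> 1\<close> by linarith+
      then have "0 \<le> k" "rat_of_int k \<le> of_nat m"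
        using m by (auto simp: zero_less_divide_iff)
      then have "k \<le> int m"
        by (metis of_int_le_iff of_int_of_nat_eq)
      then have "of_int k / of_int (int m) \<in> farey N"
        using m \<open>0 \<le> k\<close> by (intro fareyI) auto
      then show False
        using cons lt by simp
    qed
    also have "real m * of_rat r - real m * of_rat q = real m * of_rat (r - q)"
      by (simp add: of_rat_diff algebra_simps)
    also have "\<dots> = real m / (x * y)"
      by (simp add: farey_consecutive_diff[OF qr] x_def y_def of_rat_divide of_rat_mult)
    also have "real m * of_rat r \<in> \<int> \<longleftrightarrow> y dvd m"
      unfolding real_r using b(2,3) by (intro int_iff) (auto simp: y_def)
    also have "real m * of_rat q \<in> \<int> \<longleftrightarrow> x dvd m"
      unfolding real_q using a(2,3) by (intro int_iff) (auto simp: x_def)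
    finally show ?thesis .
  qed
  \<comment> \<open>Both sums vanish, so the increments given by \<open>step\<close>, weighted by
    \<open>i m\<close>, add up to 0.\<close>
  have "0 = (\<Sum>m=1..N. i m * saw (real m * of_rat r)) - (\<Sum>m=1..N. i m * saw (real m * of_rat q))"
    unfolding real_q real_r by (simp only: saw[OF xy(1)] saw[OF xy(2)])
  also have "\<dots> = (\<Sum>m=1..N. i m * (real m / (x * y) - (of_bool (y dvd m) + of_bool (x dvd m)) / 2))"
    by (simp add: step flip: sum_subtractf right_diff_distrib)
  also have "\<dots> = (\<Sum>m=1..N. real m * i m / (x * y) - ((if y dvd m then i m else 0) +
      (if x dvd m then i m else 0)) / 2)"
    by (intro sum.cong) (auto simp: field_simps)
  also have "\<dots> = M / (x * y) - (d y + d x) / 2"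
    by (simp add: M d[OF xy(1)] d[OF xy(2)] sum_subtractf sum.distrib flip: sum_divide_distrib)
  finally show "d (denom q) + d (denom r) = 2 * M / (real (denom q) * real (denom r))"
    by (simp add: x_def y_def field_simps)
qed

section \<open>Root systems\<close>

lemma inner_coroot: "x \<bullet> coroot \<gamma> = 2 * (x \<bullet> \<gamma>) / (\<gamma> \<bullet> \<gamma>)"
  by (simp add: coroot_def)

section \<open>Dual vectors and coordinates\<close>

lemma eq_if_inner_eq_on_spanning:
  fixes v w :: "'a::euclidean_space"
  assumes "span B = UNIV" "\<And>b. b \<in> B \<Longrightarrow> b \<bullet> v = b \<bullet> w"
  shows "v = w"
proof -
  have "x \<bullet> v = x \<bullet> w" for x
  proof -
    have "x \<in> span B"
      using assms(1) by simp
    then show ?thesis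
      by (induction rule: span_induct_alt) (simp_all add: assms(2) inner_add_left)
  qed
  then show ?thesis
    using vector_eq_ldot[of v w] by blast
qed

lemma dual_vector_exists:
  fixes B :: "'a::euclidean_space set"
  assumes "independent B"
  obtains w where "\<And>b. b \<in> B \<Longrightarrow> b \<bullet> w = f b"
proof -
  obtain g where g: "linear g" "\<And>b. b \<in> B \<Longrightarrow> g b = f b"
    using linear_independent_extend[OF assms, of f] by auto
  show thesis
    \<comment> \<open>The vector \<open>adjoint g 1\<close> represents the form g, since the inner
      product on the reals is multiplication.\<close>
    using that[of "adjoint g 1"] g by (simp add: adjoint_works)
qed

lemma representation_eq_inner:
  fixes B :: "'a::euclidean_space set"
  assumes "independent B" "v \<in> span B" "\<And>b. b \<in> B \<Longrightarrow> b \<bullet> w = of_bool (b = a)" "a \<in> B"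
  shows "representation B v a = v \<bullet> w"
proof -
  have fin: "finite B"
    using assms(1) by (rule independent_imp_finite)
  have "v \<bullet> w = (\<Sum>b\<in>B. representation B v b *\<^sub>R b) \<bullet> w"
    using sum_representation_eq[OF assms(1,2) fin] by simp
  also have "\<dots> = (\<Sum>b\<in>B. representation B v b * of_bool (b = a))"
    by (simp add: inner_sum_left assms(3))
  also have "\<dots> = representation B v a"
    using fin assms(4) by simp
  finally show ?thesis ..
qed

section \<open>Roots and their coefficients in the simple roots\<close>

locale irreducible_root_basis =
  fixes R \<Delta> :: "'a::euclidean_space set"
  assumes root_system: "root_system R"
    and reduced: "reduced_roots R"
    and irreducible: "irreducible_roots R"
    and simple: "simple_roots R \<Delta>"
begin

abbreviation wt :: "'a \<Rightarrow> 'a"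
  where "wt \<equiv> fund_coweight \<Delta>"

lemma finite_roots: "finite R" and zero_not_root: "0 \<notin> R" and span_roots: "span R = UNIV"
  and reflection_root: "\<gamma> \<in> R \<Longrightarrow> \<beta> \<in> R \<Longrightarrow> \<beta> - (\<beta> \<bullet> coroot \<gamma>) *\<^sub>R \<gamma> \<in> R"
  and coroot_integral: "\<gamma> \<in> R \<Longrightarrow> \<beta> \<in> R \<Longrightarrow> \<beta> \<bullet> coroot \<gamma> \<in> \<int>"
  using root_system by (auto simp: root_system_def)

lemma root_inner_pos: "\<beta> \<in> R \<Longrightarrow> \<beta> \<bullet> \<beta> > 0"
  using zero_not_root by auto

lemma uminus_root: "\<beta> \<in> R \<Longrightarrow> - \<beta> \<in> R"
  using reflection_root[of \<beta> \<beta>] root_inner_pos[of \<beta>]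
  by (simp add: inner_coroot scaleR_2)

text \<open>Both Cartan integers of the pair are positive. If one of them is 1, a reflection yields
  \<beta> - \<gamma> or its negative; if both are at least 2, the squared length of \<beta> -
  \<gamma> is at most 0.\<close>

lemma diff_root:
  assumes "\<beta> \<in> R" "\<gamma> \<in> R" "\<beta> \<bullet> \<gamma> > 0" "\<beta> \<noteq> \<gamma>"
  shows "\<beta> - \<gamma> \<in> R"
proof -
  obtain p q :: int where pq: "\<beta> \<bullet> coroot \<gamma> = of_int p" "\<gamma> \<bullet> coroot \<beta> = of_int q"
    using coroot_integral assms(1,2) by (metis Ints_cases)
  have pos: "\<beta> \<bullet> \<beta> > 0" "\<gamma> \<bullet> \<gamma> > 0"
    using assms root_inner_pos by auto
  have p: "2 * (\<beta> \<bullet> \<gamma>) = p * (\<gamma> \<bullet> \<gamma>)" and q: "2 * (\<beta> \<bullet> \<gamma>) = q * (\<beta> \<bullet> \<beta>)"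
    using pq pos by (auto simp: inner_coroot field_simps inner_commute)
  have "real_of_int p * (\<gamma> \<bullet> \<gamma>) > 0" "real_of_int q * (\<beta> \<bullet> \<beta>) > 0"
    using p q assms(3) by linarith+
  then have "p > 0" "q > 0"
    using pos by (auto simp: zero_less_mult_iff)
  then consider "p = 1" | "q = 1" | "p \<ge> 2" "q \<ge> 2"
    by linarith
  then show ?thesis
  proof cases
    case 1
    then show ?thesis
      using reflection_root[OF assms(2,1)] pq by simp
  next
    case 2
    then have "\<gamma> - \<beta> \<in> R"
      using reflection_root[OF assms(1,2)] pq by simp
    then show ?thesis
      using uminus_root by fastforce
  next
    case 3
    then have "2 * (\<gamma> \<bullet> \<gamma>) \<le> p * (\<gamma> \<bullet> \<gamma>)" "2 * (\<beta> \<bullet> \<beta>) \<le> q * (\<beta> \<bullet> \<beta>)"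
      using pos by (intro mult_right_mono; simp)+
    then have "(\<beta> - \<gamma>) \<bullet> (\<beta> - \<gamma>) \<le> 0"
      using p q by (simp add: inner_diff_left inner_diff_right inner_commute)
    then show ?thesis
      using assms(4) by (simp add: not_less[symmetric])
  qed
qed

lemma add_root:
  assumes "\<beta> \<in> R" "\<gamma> \<in> R" "\<beta> \<bullet> \<gamma> < 0" "\<beta> \<noteq> - \<gamma>"
  shows "\<beta> + \<gamma> \<in> R"
  using diff_root[of \<beta> "- \<gamma>"] uminus_root assms by simp

lemma simple_root: "\<gamma> \<in> \<Delta> \<Longrightarrow> \<gamma> \<in> R" and independent_simple: "independent \<Delta>"
  using simple by (auto simp: simple_roots_def)

lemma finite_simple: "finite \<Delta>"
  using independent_simple by (rule independent_imp_finite)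

lemma span_simple: "span \<Delta> = UNIV"
proof -
  have "\<beta> \<in> span \<Delta>" if \<beta>: "\<beta> \<in> R" for \<beta>
  proof -
    obtain n :: "'a \<Rightarrow> nat" where
      "\<beta> = (\<Sum>\<alpha>\<in>\<Delta>. real (n \<alpha>) *\<^sub>R \<alpha>) \<or> \<beta> = - (\<Sum>\<alpha>\<in>\<Delta>. real (n \<alpha>) *\<^sub>R \<alpha>)"
      using simple \<beta> unfolding simple_roots_def by blast
    moreover have "(\<Sum>\<alpha>\<in>\<Delta>. real (n \<alpha>) *\<^sub>R \<alpha>) \<in> span \<Delta>"
      by (intro span_sum span_scale span_base)
    ultimately show ?thesis
      by (auto intro: span_neg)
  qed
  then have "span R \<subseteq> span \<Delta>"
    by (intro span_minimal) auto
  then show ?thesis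
    using span_roots by auto
qed

lemma inner_coweight:
  assumes "\<gamma> \<in> \<Delta>" "\<beta> \<in> \<Delta>"
  shows "\<beta> \<bullet> wt \<gamma> = of_bool (\<beta> = \<gamma>)"
proof -
  obtain w where w: "\<forall>\<beta>\<in>\<Delta>. \<beta> \<bullet> w = (if \<beta> = \<gamma> then 1 else 0)"
    using dual_vector_exists[OF independent_simple, of "\<lambda>\<beta>. if \<beta> = \<gamma> then 1 else 0"] by metis
  have "wt \<gamma> = w"
    unfolding fund_coweight_def
    using w eq_if_inner_eq_on_spanning[OF span_simple] by (intro the_equality) auto
  then show ?thesis
    using w assms by simp
qed

lemma representation_simple: "\<gamma> \<in> \<Delta> \<Longrightarrow> representation \<Delta> x \<gamma> = x \<bullet> wt \<gamma>"
  by (intro representation_eq_inner) (auto simp: independent_simple span_simple inner_coweight)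

lemma simple_expansion: "(\<Sum>\<gamma>\<in>\<Delta>. (x \<bullet> wt \<gamma>) *\<^sub>R \<gamma>) = x"
  using sum_representation_eq[OF independent_simple _ finite_simple order_refl, of x]
  by (simp add: span_simple representation_simple)

lemma inner_expansion: "x \<bullet> y = (\<Sum>\<gamma>\<in>\<Delta>. (x \<bullet> wt \<gamma>) * (\<gamma> \<bullet> y))"
  by (subst simple_expansion[of x, symmetric]) (simp add: inner_sum_left)

lemma eq_if_coefficients_eq:
  assumes "\<And>\<gamma>. \<gamma> \<in> \<Delta> \<Longrightarrow> x \<bullet> wt \<gamma> = y \<bullet> wt \<gamma>"
  shows "x = y"
proof -
  have "(\<Sum>\<gamma>\<in>\<Delta>. (x \<bullet> wt \<gamma>) *\<^sub>R \<gamma>) = (\<Sum>\<gamma>\<in>\<Delta>. (y \<bullet> wt \<gamma>) *\<^sub>R \<gamma>)"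
    by (simp add: assms)
  then show ?thesis
    by (simp only: simple_expansion)
qed

lemma root_coefficients:
  assumes "\<beta> \<in> R"
  shows "(\<forall>\<gamma>\<in>\<Delta>. \<beta> \<bullet> wt \<gamma> \<in> \<nat>) \<or> (\<forall>\<gamma>\<in>\<Delta>. - (\<beta> \<bullet> wt \<gamma>) \<in> \<nat>)"
proof -
  obtain n :: "'a \<Rightarrow> nat" where n:
    "\<beta> = (\<Sum>\<alpha>\<in>\<Delta>. real (n \<alpha>) *\<^sub>R \<alpha>) \<or> \<beta> = - (\<Sum>\<alpha>\<in>\<Delta>. real (n \<alpha>) *\<^sub>R \<alpha>)"
    using simple assms unfolding simple_roots_def by blast
  have "(\<Sum>\<alpha>\<in>\<Delta>. real (n \<alpha>) *\<^sub>R \<alpha>) \<bullet> wt \<gamma> = real (n \<gamma>)" if "\<gamma> \<in> \<Delta>" for \<gamma>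
    using that finite_simple by (simp add: inner_sum_left inner_coweight)
  then show ?thesis
    using n by auto
qed

lemma coefficient_integral: "\<beta> \<in> R \<Longrightarrow> \<gamma> \<in> \<Delta> \<Longrightarrow> \<beta> \<bullet> wt \<gamma> \<in> \<int>"
  using root_coefficients[of \<beta>] Nats_subset_Ints minus_in_Ints_iff[of "\<beta> \<bullet> wt \<gamma>"] by blast

lemma coefficients_same_sign:
  assumes "\<beta> \<in> R" "\<gamma> \<in> \<Delta>" "\<beta> \<bullet> wt \<gamma> > 0" "\<delta> \<in> \<Delta>"
  shows "\<beta> \<bullet> wt \<delta> \<ge> 0"
proof -
  have nonneg: "x \<ge> 0" if "x \<in> \<nat>" for x :: real
    using that by (auto elim: Nats_cases)
  show ?thesis
    using root_coefficients[OF assms(1)] nonneg[of "- (\<beta> \<bullet> wt \<gamma>)"] nonneg[of "\<beta> \<bullet> wt \<delta>"] assms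
    by auto
qed

section \<open>Heights and positive roots\<close>

text \<open>The height, extended linearly to the whole space: its sign decides whether a root is
  positive, and it is the measure for all extremal choices of roots below.\<close>

definition ht :: "'a \<Rightarrow> real"
  where "ht \<beta> = (\<Sum>\<gamma>\<in>\<Delta>. \<beta> \<bullet> wt \<gamma>)"

lemma ht_add: "ht (x + y) = ht x + ht y" and ht_diff: "ht (x - y) = ht x - ht y"
  and ht_minus: "ht (- x) = - ht x"
  by (simp_all add: ht_def inner_add_left inner_diff_left sum.distrib sum_subtractf sum_negf)

lemma ht_simple: "\<gamma> \<in> \<Delta> \<Longrightarrow> ht \<gamma> = 1"
  using finite_simple by (simp add: ht_def inner_coweight)

text \<open>One positive coefficient excludes negative ones, so a single coordinate certifies that a
  root is positive.\<close>

lemma ht_posI: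
  assumes "\<beta> \<in> R" "\<gamma> \<in> \<Delta>" "\<beta> \<bullet> wt \<gamma> > 0"
  shows "ht \<beta> > 0"
  unfolding ht_def using assms finite_simple coefficients_same_sign[OF assms]
  by (intro sum_pos2[of _ \<gamma>]) auto

lemma coefficient_nonneg:
  assumes "\<beta> \<in> R" "ht \<beta> > 0" "\<gamma> \<in> \<Delta>"
  shows "\<beta> \<bullet> wt \<gamma> \<ge> 0"
proof (rule ccontr)
  assume "\<not> \<beta> \<bullet> wt \<gamma> \<ge> 0"
  then have "ht (- \<beta>) > 0"
    using assms uminus_root by (intro ht_posI[of _ \<gamma>]) auto
  then show False
    using assms by (simp add: ht_minus)
qed

lemma ht_nonzero:
  assumes "\<beta> \<in> R"
  shows "ht \<beta> \<noteq> 0"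
proof
  assume 0: "ht \<beta> = 0"
  have "\<beta> \<bullet> wt \<gamma> = 0" if "\<gamma> \<in> \<Delta>" for \<gamma>
    using ht_posI[of \<beta> \<gamma>] ht_posI[of "- \<beta>" \<gamma>] assms uminus_root[OF assms] that 0
    by (cases "\<beta> \<bullet> wt \<gamma>" "0 :: real" rule: linorder_cases) (simp_all add: ht_minus)
  then have "\<beta> = 0"
    by (intro eq_if_coefficients_eq) simp
  then show False
    using assms zero_not_root by simp
qed

text \<open>The squared length of \<beta> is the sum of its coefficients times inner products with
  simple roots, so some summand is positive. By \<open>diff_root\<close> this \<gamma> can be
  subtracted from \<beta>, unless \<beta> equals \<gamma>: the descent in height.\<close>

lemma positive_root_inner_simple:
  assumes "\<beta> \<in> R" "ht \<beta> > 0"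
  obtains \<gamma> where "\<gamma> \<in> \<Delta>" "\<beta> \<bullet> \<gamma> > 0" "\<beta> \<bullet> wt \<gamma> > 0"
proof -
  have "(\<Sum>\<gamma>\<in>\<Delta>. (\<beta> \<bullet> wt \<gamma>) * (\<gamma> \<bullet> \<beta>)) > 0"
    using root_inner_pos[OF assms(1)] inner_expansion[of \<beta> \<beta>] by simp
  then obtain \<gamma> where "\<gamma> \<in> \<Delta>" "(\<beta> \<bullet> wt \<gamma>) * (\<gamma> \<bullet> \<beta>) > 0"
    by (meson not_le sum_nonpos)
  then show thesis
    using that[of \<gamma>] coefficient_nonneg[OF assms] by (force simp: zero_less_mult_iff inner_commute)
qed

text \<open>Otherwise \<gamma> - \<delta> would be a root with coefficients of both signs.\<close>

lemma simple_inner_nonpos: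
  assumes "\<gamma> \<in> \<Delta>" "\<delta> \<in> \<Delta>" "\<gamma> \<noteq> \<delta>"
  shows "\<gamma> \<bullet> \<delta> \<le> 0"
proof (rule ccontr)
  assume "\<not> \<gamma> \<bullet> \<delta> \<le> 0"
  then have "\<gamma> - \<delta> \<in> R"
    using assms simple_root by (intro diff_root) auto
  from coefficients_same_sign[OF this, of \<gamma> \<delta>] show False
    using assms by (simp add: inner_diff_left inner_coweight)
qed

section \<open>Connectedness of the simple roots\<close>

text \<open>Take a positive root \<beta> of least height whose support meets both sides, and
  subtract a simple \<gamma>. By minimality \<beta> - \<gamma> lives on one side, necessarily the
  one without \<gamma>, so it is orthogonal to \<gamma>. The reflection of \<beta> in \<gamma> is
  then \<beta> - 2\<gamma>, with coefficient -1 at \<gamma> and a positive one on the other side,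
  which no root has.\<close>

lemma root_support_orthogonal_split:
  assumes "S \<subseteq> \<Delta>" and orth: "\<And>\<gamma> \<delta>. \<gamma> \<in> S \<Longrightarrow> \<delta> \<in> \<Delta> - S \<Longrightarrow> \<gamma> \<bullet> \<delta> = 0" and "\<beta> \<in> R"
  shows "(\<forall>\<delta>\<in>\<Delta> - S. \<beta> \<bullet> wt \<delta> = 0) \<or> (\<forall>\<gamma>\<in>S. \<beta> \<bullet> wt \<gamma> = 0)"
proof -
  define Bad where "Bad = {\<beta> \<in> R. ht \<beta> > 0 \<and>
    (\<exists>\<delta>\<in>\<Delta> - S. \<beta> \<bullet> wt \<delta> \<noteq> 0) \<and> (\<exists>\<gamma>\<in>S. \<beta> \<bullet> wt \<gamma> \<noteq> 0)}"
  have "Bad = {}"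
  proof (rule ccontr)
    assume "Bad \<noteq> {}"
    moreover have "finite Bad"
      using finite_roots by (simp add: Bad_def)
    ultimately obtain \<beta> where "is_arg_min ht (\<lambda>\<beta>. \<beta> \<in> Bad) \<beta>"
      using ex_is_arg_min_if_finite[of Bad ht] by blast
    then have bad: "\<beta> \<in> Bad" and min: "\<And>\<beta>'. \<beta>' \<in> Bad \<Longrightarrow> ht \<beta> \<le> ht \<beta>'"
      by (auto simp: is_arg_min_linorder)
    have \<beta>: "\<beta> \<in> R" "ht \<beta> > 0"
      using bad by (auto simp: Bad_def)
    obtain \<gamma> where \<gamma>: "\<gamma> \<in> \<Delta>" "\<beta> \<bullet> \<gamma> > 0"
      using positive_root_inner_simple[OF \<beta>] by blast
    have two: "\<exists>\<delta>\<in>T. \<beta> \<bullet> wt \<delta> > 0" if T: "T = S \<or> T = \<Delta> - S" for T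
    proof -
      have "\<exists>\<delta>\<in>S. \<beta> \<bullet> wt \<delta> \<noteq> 0" "\<exists>\<delta>\<in>\<Delta> - S. \<beta> \<bullet> wt \<delta> \<noteq> 0"
        using bad by (simp_all add: Bad_def)
      then obtain \<delta> where "\<delta> \<in> T" "\<beta> \<bullet> wt \<delta> \<noteq> 0"
        using T by blast
      then show ?thesis
        using coefficient_nonneg[OF \<beta>, of \<delta>] assms(1) T by (metis DiffD1 less_eq_real_def subsetD)
    qed
    \<comment> \<open>U is the side that does not contain \<gamma>. A positive coefficient of
      \<beta> there survives the subtraction and keeps \<beta> - \<gamma> positive.\<close>
    define U where "U = (if \<gamma> \<in> S then \<Delta> - S else S)"
    have "U = S \<or> U = \<Delta> - S"
      by (simp add: U_def)
    then obtain \<delta> where "\<delta> \<in> U" "\<beta> \<bullet> wt \<delta> > 0"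
      using two by blast
    then have \<delta>: "\<delta> \<in> \<Delta>" "\<delta> \<noteq> \<gamma>" "\<beta> \<bullet> wt \<delta> > 0"
      using assms(1) by (auto simp: U_def split: if_splits)
    have "\<beta> \<noteq> \<gamma>"
      using \<delta> \<gamma> by (auto simp: inner_coweight)
    then have diff: "\<beta> - \<gamma> \<in> R"
      using diff_root \<beta> \<gamma> simple_root by blast
    have "ht (\<beta> - \<gamma>) > 0"
      using diff \<delta> \<gamma> by (intro ht_posI[of _ \<delta>]) (auto simp: inner_diff_left inner_coweight)
    moreover have "\<beta> - \<gamma> \<notin> Bad"
      using min[of "\<beta> - \<gamma>"] \<gamma> by (auto simp: ht_diff ht_simple)
    ultimately have "(\<forall>\<delta>\<in>\<Delta> - S. (\<beta> - \<gamma>) \<bullet> wt \<delta> = 0) \<or> (\<forall>\<delta>\<in>\<Delta> - (\<Delta> - S). (\<beta> - \<gamma>) \<bullet> wt \<delta> = 0)"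
      using diff unfolding Bad_def by blast
    then obtain T where T: "T = S \<or> T = \<Delta> - S" and
      off: "\<And>\<delta>. \<delta> \<in> \<Delta> - T \<Longrightarrow> (\<beta> - \<gamma>) \<bullet> wt \<delta> = 0"
      by blast
    have "\<gamma> \<notin> T"
    proof
      assume "\<gamma> \<in> T"
      have "\<Delta> - T = \<Delta> - S \<or> \<Delta> - T = S"
        using T assms(1) by blast
      then obtain \<delta> where "\<delta> \<in> \<Delta> - T" "\<beta> \<bullet> wt \<delta> > 0"
        using two[of "\<Delta> - T"] by blast
      then show False
        using off[of \<delta>] \<gamma> \<open>\<gamma> \<in> T\<close> by (auto simp: inner_diff_left inner_coweight)
    qed
    have "(\<beta> - \<gamma>) \<bullet> \<gamma> = 0"
      unfolding inner_expansion[of "\<beta> - \<gamma>" \<gamma>]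
    proof (intro sum.neutral ballI)
      fix \<delta> assume "\<delta> \<in> \<Delta>"
      moreover have "\<delta> \<bullet> \<gamma> = 0" if "\<delta> \<in> T"
        using T
      proof
        assume "T = S"
        then show ?thesis
          using orth[of \<delta> \<gamma>] that \<open>\<gamma> \<notin> T\<close> \<gamma> by blast
      next
        assume "T = \<Delta> - S"
        then show ?thesis
          using orth[of \<gamma> \<delta>] that \<open>\<gamma> \<notin> T\<close> \<gamma> by (simp add: inner_commute)
      qed
      ultimately show "((\<beta> - \<gamma>) \<bullet> wt \<delta>) * (\<delta> \<bullet> \<gamma>) = 0"
        using off[of \<delta>] by (cases "\<delta> \<in> T") auto
    qed
    then have "\<beta> \<bullet> coroot \<gamma> = 2"
      using root_inner_pos[of \<gamma>] simple_root \<gamma> by (simp add: inner_coroot inner_diff_left)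
    then have refl: "\<beta> - 2 *\<^sub>R \<gamma> \<in> R"
      using reflection_root[of \<gamma> \<beta>] \<beta> \<gamma> simple_root by simp
    obtain \<delta> where \<delta>: "\<delta> \<in> T" "\<beta> \<bullet> wt \<delta> > 0"
      using two T by blast
    have "\<delta> \<in> \<Delta>" "\<delta> \<noteq> \<gamma>"
      using \<delta> T assms(1) \<open>\<gamma> \<notin> T\<close> by blast+
    then have "(\<beta> - 2 *\<^sub>R \<gamma>) \<bullet> wt \<gamma> \<ge> 0"
      using \<delta> \<gamma> by (intro coefficients_same_sign[OF refl, of \<delta>])
        (auto simp: inner_diff_left inner_coweight)
    then show False
      using off[of \<gamma>] \<gamma> \<open>\<gamma> \<notin> T\<close> by (simp add: inner_diff_left inner_coweight)
  qed
  then have "\<beta> \<notin> Bad" "- \<beta> \<notin> Bad"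
    by simp_all
  moreover have "ht \<beta> > 0 \<or> ht (- \<beta>) > 0"
    using ht_nonzero[OF assms(3)] by (auto simp: ht_minus)
  ultimately show ?thesis
    using assms(3) uminus_root[OF assms(3)] unfolding Bad_def by (elim disjE) simp_all
qed

text \<open>Carries irreducibility from R to the simple roots: an orthogonal splitting of the simple
  roots would split all roots into those supported on S and those supported off S, and these two
  sets are orthogonal.\<close>

lemma simple_roots_connected:
  assumes "S \<subseteq> \<Delta>" "S \<noteq> {}" and orth: "\<And>\<gamma> \<delta>. \<gamma> \<in> S \<Longrightarrow> \<delta> \<in> \<Delta> - S \<Longrightarrow> \<gamma> \<bullet> \<delta> = 0"
  shows "S = \<Delta>"
proof (rule ccontr)
  assume "S \<noteq> \<Delta>"
  define A B where "A = {\<beta> \<in> R. \<forall>\<delta>\<in>\<Delta> - S. \<beta> \<bullet> wt \<delta> = 0}"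
    and "B = {\<beta> \<in> R. \<forall>\<gamma>\<in>S. \<beta> \<bullet> wt \<gamma> = 0}"
  have "R = A \<union> B"
    using root_support_orthogonal_split[OF assms(1) orth] by (auto simp: A_def B_def)
  moreover have "S \<subseteq> A" "\<Delta> - S \<subseteq> B"
    using assms(1) simple_root by (auto simp: A_def B_def inner_coweight subset_iff)
  then have "A \<noteq> {}" "B \<noteq> {}"
    using assms(1,2) \<open>S \<noteq> \<Delta>\<close> by auto
  moreover have "\<beta> \<bullet> \<beta>' = 0" if "\<beta> \<in> A" "\<beta>' \<in> B" for \<beta> \<beta>'
  proof -
    have "\<gamma> \<bullet> \<beta>' = 0" if "\<gamma> \<in> S" for \<gamma>
      unfolding inner_commute[of \<gamma>] inner_expansion[of \<beta>' \<gamma>]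
    proof (intro sum.neutral ballI)
      fix \<delta> assume "\<delta> \<in> \<Delta>"
      then show "(\<beta>' \<bullet> wt \<delta>) * (\<delta> \<bullet> \<gamma>) = 0"
        using \<open>\<beta>' \<in> B\<close> orth[OF that, of \<delta>] by (cases "\<delta> \<in> S") (auto simp: B_def inner_commute)
    qed
    then show ?thesis
      unfolding inner_expansion[of \<beta> \<beta>']
      using \<open>\<beta> \<in> A\<close> by (intro sum.neutral ballI) (auto simp: A_def)
  qed
  ultimately show False
    using irreducible unfolding irreducible_roots_def by blast
qed

section \<open>The highest root\<close>

text \<open>A root \<theta> of maximal height is dominant, since a simple root could otherwise be
  added. Connectedness gives it full support. A root with a coefficient above that of \<theta> can
  also be chosen dominant; it then has positive inner product with \<theta>, and its difference with
  \<theta> is a root of positive height, against maximality.\<close>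

lemma highest_root_exists: "\<exists>\<theta>\<in>R. \<forall>\<beta>\<in>R. \<forall>\<gamma>\<in>\<Delta>. \<beta> \<bullet> wt \<gamma> \<le> \<theta> \<bullet> wt \<gamma>"
proof -
  have "R \<noteq> {}"
    using irreducible by (simp add: irreducible_roots_def)
  then obtain \<theta> where "is_arg_min (\<lambda>\<beta>. - ht \<beta>) (\<lambda>\<beta>. \<beta> \<in> R) \<theta>"
    using finite_roots ex_is_arg_min_if_finite[of R "\<lambda>\<beta>. - ht \<beta>"] by blast
  then have \<theta>: "\<theta> \<in> R" and max: "\<And>\<beta>. \<beta> \<in> R \<Longrightarrow> ht \<beta> \<le> ht \<theta>"
    by (auto simp: is_arg_min_linorder)
  have "ht \<theta> > 0"
    using max[of \<theta>] max[of "- \<theta>"] \<theta> ht_nonzero[OF \<theta>] uminus_root[OF \<theta>] by (simp add: ht_minus)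
  have dominant: "\<theta> \<bullet> \<gamma> \<ge> 0" if \<gamma>: "\<gamma> \<in> \<Delta>" for \<gamma>
  proof (rule ccontr)
    assume "\<not> \<theta> \<bullet> \<gamma> \<ge> 0"
    moreover have "\<theta> \<noteq> - \<gamma>"
      using \<open>ht \<theta> > 0\<close> \<gamma> by (auto simp: ht_minus ht_simple)
    ultimately have "\<theta> + \<gamma> \<in> R"
      using \<theta> \<gamma> simple_root by (intro add_root) auto
    then show False
      using max[of "\<theta> + \<gamma>"] \<gamma> by (simp add: ht_add ht_simple)
  qed
  define S where "S = {\<gamma> \<in> \<Delta>. \<theta> \<bullet> wt \<gamma> > 0}"
  have "S = \<Delta>"
  proof (rule simple_roots_connected)
    obtain \<gamma> where "\<gamma> \<in> \<Delta>" "\<theta> \<bullet> wt \<gamma> > 0"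
      using positive_root_inner_simple[OF \<theta> \<open>ht \<theta> > 0\<close>] by blast
    then show "S \<noteq> {}"
      by (auto simp: S_def)
    fix \<gamma> \<delta> assume \<gamma>: "\<gamma> \<in> S" and \<delta>: "\<delta> \<in> \<Delta> - S"
    have np: "(\<theta> \<bullet> wt \<epsilon>) * (\<epsilon> \<bullet> \<delta>) \<le> 0" if "\<epsilon> \<in> \<Delta>" for \<epsilon>
      using that coefficient_nonneg[OF \<theta> \<open>ht \<theta> > 0\<close> that] \<delta> simple_inner_nonpos[of \<epsilon> \<delta>]
      by (cases "\<epsilon> = \<delta>") (auto simp: S_def mult_nonneg_nonpos)
    \<comment> \<open>The sum is the inner product of \<theta> with \<delta>: nonnegative by
      dominance, yet made of nonpositive terms because \<delta> lies outside the support. So each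
      term is 0.\<close>
    have "(\<Sum>\<epsilon>\<in>\<Delta>. (\<theta> \<bullet> wt \<epsilon>) * (\<epsilon> \<bullet> \<delta>)) = 0"
      using dominant[of \<delta>] \<delta> np by (intro antisym sum_nonpos) (auto simp: inner_expansion[of \<theta> \<delta>])
    then have "(\<Sum>\<epsilon>\<in>\<Delta>. - ((\<theta> \<bullet> wt \<epsilon>) * (\<epsilon> \<bullet> \<delta>))) = 0"
      by (simp only: sum_negf)
    moreover have "\<gamma> \<in> \<Delta>"
      using \<gamma> by (simp add: S_def)
    ultimately have "- ((\<theta> \<bullet> wt \<gamma>) * (\<gamma> \<bullet> \<delta>)) = 0"
      using np finite_simple
        sum_nonneg_eq_0_iff[of \<Delta> "\<lambda>\<epsilon>. - ((\<theta> \<bullet> wt \<epsilon>) * (\<epsilon> \<bullet> \<delta>))"]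
      by (simp del: neg_equal_0_iff_equal mult_eq_0_iff)
    then show "\<gamma> \<bullet> \<delta> = 0"
      using \<gamma> by (simp add: S_def)
  qed (auto simp: S_def)
  then have full: "\<theta> \<bullet> wt \<gamma> > 0" if "\<gamma> \<in> \<Delta>" for \<gamma>
    using that by (auto simp: S_def)
  define Bad where "Bad = {\<beta> \<in> R. \<exists>\<gamma>\<in>\<Delta>. \<beta> \<bullet> wt \<gamma> > \<theta> \<bullet> wt \<gamma>}"
  have "Bad = {}"
  proof (rule ccontr)
    assume "Bad \<noteq> {}"
    moreover have "finite Bad"
      using finite_roots by (simp add: Bad_def)
    ultimately obtain \<beta> where "is_arg_min (\<lambda>\<beta>. - ht \<beta>) (\<lambda>\<beta>. \<beta> \<in> Bad) \<beta>"
      using ex_is_arg_min_if_finite[of Bad "\<lambda>\<beta>. - ht \<beta>"] by blast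
    then have bad: "\<beta> \<in> Bad" and max': "\<And>\<beta>'. \<beta>' \<in> Bad \<Longrightarrow> ht \<beta>' \<le> ht \<beta>"
      by (auto simp: is_arg_min_linorder)
    then obtain \<gamma> where \<gamma>: "\<beta> \<in> R" "\<gamma> \<in> \<Delta>" "\<beta> \<bullet> wt \<gamma> > \<theta> \<bullet> wt \<gamma>"
      by (auto simp: Bad_def)
    have pos: "ht \<beta> > 0"
      using \<gamma> full[of \<gamma>] by (intro ht_posI[of _ \<gamma>]) auto
    have "\<beta> \<bullet> \<delta> \<ge> 0" if \<delta>: "\<delta> \<in> \<Delta>" for \<delta>
    proof (rule ccontr)
      assume "\<not> \<beta> \<bullet> \<delta> \<ge> 0"
      moreover have "\<beta> \<noteq> - \<delta>"
        using pos \<delta> by (auto simp: ht_minus ht_simple)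
      ultimately have "\<beta> + \<delta> \<in> R"
        using \<gamma> \<delta> simple_root by (intro add_root) auto
      moreover have "(\<beta> + \<delta>) \<bullet> wt \<gamma> > \<theta> \<bullet> wt \<gamma>"
        using \<gamma> \<delta> by (auto simp: inner_add_left inner_coweight)
      ultimately have "\<beta> + \<delta> \<in> Bad"
        using \<gamma> by (auto simp: Bad_def)
      then show False
        using max'[of "\<beta> + \<delta>"] \<delta> by (simp add: ht_add ht_simple)
    qed
    moreover obtain \<delta> where "\<delta> \<in> \<Delta>" "\<beta> \<bullet> \<delta> > 0"
      using positive_root_inner_simple[OF \<gamma>(1) pos] by blast
    \<comment> \<open>All coefficients of \<theta> are positive, while \<beta> is dominant and pairs
      strictly positively with one simple root.\<close>
    ultimately have "\<theta> \<bullet> \<beta> > 0"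
      unfolding inner_expansion[of \<theta> \<beta>] using full finite_simple
      by (intro sum_pos2[of _ \<delta>]) (auto simp: inner_commute less_imp_le)
    then have diff: "\<beta> - \<theta> \<in> R"
      using \<gamma> \<theta> by (intro diff_root) (auto simp: inner_commute)
    have "ht (\<beta> - \<theta>) > 0"
      using \<gamma> by (intro ht_posI[OF diff, of \<gamma>]) (auto simp: inner_diff_left)
    then show False
      using max[of \<beta>] \<gamma> by (simp add: ht_diff)
  qed
  then have "\<forall>\<beta>\<in>R. \<forall>\<gamma>\<in>\<Delta>. \<beta> \<bullet> wt \<gamma> \<le> \<theta> \<bullet> wt \<gamma>"
    by (force simp: Bad_def not_less)
  then show ?thesis
    using \<theta> by blast
qed

abbreviation \<theta> :: 'a
  where "\<theta> \<equiv> highest_root R \<Delta>"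

lemma highest_root: "\<theta> \<in> R"
  and coefficient_le_highest_root: "\<And>\<beta> \<gamma>. \<beta> \<in> R \<Longrightarrow> \<gamma> \<in> \<Delta> \<Longrightarrow> \<beta> \<bullet> wt \<gamma> \<le> \<theta> \<bullet> wt \<gamma>"
proof -
  obtain \<theta>' where \<theta>': "\<theta>' \<in> R" "\<And>\<beta> \<gamma>. \<beta> \<in> R \<Longrightarrow> \<gamma> \<in> \<Delta> \<Longrightarrow> \<beta> \<bullet> wt \<gamma> \<le> \<theta>' \<bullet> wt \<gamma>"
    using highest_root_exists by blast
  have "\<theta> = \<theta>'"
    unfolding highest_root_def
  proof (rule the_equality)
    fix \<theta>'' assume "\<theta>'' \<in> R \<and> (\<forall>\<beta>\<in>R. \<forall>\<gamma>\<in>\<Delta>. representation \<Delta> \<beta> \<gamma> \<le> representation \<Delta> \<theta>'' \<gamma>)"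
    then show "\<theta>'' = \<theta>'"
      using \<theta>' by (intro eq_if_coefficients_eq antisym) (auto simp: representation_simple)
  qed (use \<theta>' in \<open>simp add: representation_simple\<close>)
  then show "\<theta> \<in> R" "\<And>\<beta> \<gamma>. \<beta> \<in> R \<Longrightarrow> \<gamma> \<in> \<Delta> \<Longrightarrow> \<beta> \<bullet> wt \<gamma> \<le> \<theta> \<bullet> wt \<gamma>"
    using \<theta>' by auto
qed

lemma highest_root_coefficient_ge_1: "\<gamma> \<in> \<Delta> \<Longrightarrow> \<theta> \<bullet> wt \<gamma> \<ge> 1"
  using coefficient_le_highest_root[of \<gamma> \<gamma>] by (simp add: simple_root inner_coweight)

lemma highest_root_dominant:
  assumes "\<gamma> \<in> \<Delta>"
  shows "\<theta> \<bullet> \<gamma> \<ge> 0"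
proof (rule ccontr)
  assume "\<not> \<theta> \<bullet> \<gamma> \<ge> 0"
  moreover have "\<theta> \<bullet> wt \<gamma> \<noteq> (- \<gamma>) \<bullet> wt \<gamma>"
    using highest_root_coefficient_ge_1[of \<gamma>] assms by (simp add: inner_coweight)
  ultimately have "\<theta> + \<gamma> \<in> R"
    using highest_root assms simple_root by (intro add_root) auto
  from coefficient_le_highest_root[OF this assms] show False
    using assms by (simp add: inner_add_left inner_coweight)
qed

lemma highest_root_inner_nonneg:
  assumes "\<beta> \<in> R" "ht \<beta> > 0"
  shows "\<beta> \<bullet> \<theta> \<ge> 0"
  unfolding inner_expansion[of \<beta> \<theta>]
  using assms coefficient_nonneg highest_root_dominant
  by (intro sum_nonneg mult_nonneg_nonneg) (auto simp: inner_commute)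

text \<open>Removing a simple root lowers the level by at most 1, and from a root of least height
  among those of level at least k it must push the level below k. So no level is skipped. This gives
  the positivity of the weights and the extra root of level x.\<close>

lemma root_of_level:
  assumes "\<alpha> \<in> \<Delta>" "1 \<le> k" "real k \<le> \<theta> \<bullet> wt \<alpha>"
  obtains \<beta> where "\<beta> \<in> R" "\<beta> \<bullet> wt \<alpha> = real k"
proof -
  define L where "L = {\<beta> \<in> R. real k \<le> \<beta> \<bullet> wt \<alpha>}"
  have "L \<noteq> {}" "finite L"
    using assms highest_root finite_roots by (auto simp: L_def)
  then obtain \<beta> where "is_arg_min ht (\<lambda>\<beta>. \<beta> \<in> L) \<beta>"
    using ex_is_arg_min_if_finite[of L ht] by blast
  then have "\<beta> \<in> L" and min: "\<And>\<beta>'. \<beta>' \<in> L \<Longrightarrow> ht \<beta> \<le> ht \<beta>'"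
    by (auto simp: is_arg_min_linorder)
  then have \<beta>: "\<beta> \<in> R" "real k \<le> \<beta> \<bullet> wt \<alpha>"
    by (auto simp: L_def)
  have "ht \<beta> > 0"
    using \<beta> assms by (intro ht_posI[of _ \<alpha>]) auto
  then obtain \<gamma> where \<gamma>: "\<gamma> \<in> \<Delta>" "\<beta> \<bullet> \<gamma> > 0"
    using positive_root_inner_simple[OF \<beta>(1)] by blast
  have "\<beta> \<bullet> wt \<alpha> = real k"
  proof (cases "\<beta> = \<gamma>")
    case True
    \<comment> \<open>A simple root has level 0 or 1, so \<gamma> is \<alpha> and k is 1.\<close>
    then show ?thesis
      using \<beta> \<gamma> assms by (cases "\<gamma> = \<alpha>") (auto simp: inner_coweight)
  next
    case False
    then have "\<beta> - \<gamma> \<in> R"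
      using \<beta> \<gamma> simple_root by (intro diff_root) auto
    moreover have "\<beta> - \<gamma> \<notin> L"
      using min[of "\<beta> - \<gamma>"] \<gamma> by (auto simp: ht_diff ht_simple)
    ultimately have "\<beta> \<bullet> wt \<alpha> < real k + of_bool (\<gamma> = \<alpha>)"
      using \<gamma> assms by (auto simp: L_def inner_diff_left inner_coweight)
    then have "\<beta> \<bullet> wt \<alpha> < real k + 1"
      by (auto simp: of_bool_def split: if_splits)
    moreover obtain n where n: "\<beta> \<bullet> wt \<alpha> = of_int n"
      using coefficient_integral \<beta> assms by (metis Ints_cases)
    ultimately have "n = int k"
      using \<beta>(2) by linarith
    then show ?thesis
      using n by simp
  qed
  then show thesis
    using that \<beta> by blast
qed

abbreviation posroots :: "'a set"
  where "posroots \<equiv> {\<beta> \<in> R. 0 < ht \<beta>}"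

section \<open>Sums over roots and the invariant form\<close>

text \<open>The odd function l picks one root of each opposite pair. It is the height, which
  vanishes on no root, or the level, where roots of level 0 contribute nothing.\<close>

lemma sum_even_roots:
  fixes l :: "'a \<Rightarrow> real" and f :: "'a \<Rightarrow> real"
  assumes "\<And>\<beta>. l (- \<beta>) = - l \<beta>"
    and "\<And>\<beta>. \<beta> \<in> R \<Longrightarrow> f (- \<beta>) = f \<beta>" and "\<And>\<beta>. \<beta> \<in> R \<Longrightarrow> l \<beta> = 0 \<Longrightarrow> f \<beta> = 0"
  shows "(\<Sum>\<beta>\<in>R. f \<beta>) = 2 * (\<Sum>\<beta> | \<beta> \<in> R \<and> 0 < l \<beta>. f \<beta>)"
proof -
  have "(\<Sum>\<beta>\<in>R. f \<beta>) = (\<Sum>\<beta>\<in>R. (if 0 < l \<beta> then f \<beta> else 0) + (if 0 < l (- \<beta>) then f \<beta> else 0))"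
  proof (rule sum.cong[OF refl])
    fix \<beta> assume "\<beta> \<in> R"
    then show "f \<beta> = (if 0 < l \<beta> then f \<beta> else 0) + (if 0 < l (- \<beta>) then f \<beta> else 0)"
      using assms(3)[of \<beta>] by (cases "l \<beta>" "0 :: real" rule: linorder_cases) (simp_all add: assms(1))
  qed
  also have "\<dots> = (\<Sum>\<beta>\<in>R. if 0 < l \<beta> then f \<beta> else 0) + (\<Sum>\<beta>\<in>R. if 0 < l (- \<beta>) then f \<beta> else 0)"
    by (rule sum.distrib)
  also have "(\<Sum>\<beta>\<in>R. if 0 < l (- \<beta>) then f \<beta> else 0) = (\<Sum>\<beta>\<in>R. if 0 < l \<beta> then f \<beta> else 0)"
    by (rule sum.reindex_bij_witness[of _ uminus uminus]) (auto simp: uminus_root assms(2))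
  finally show ?thesis
    by (simp add: finite_roots flip: sum.inter_filter)
qed

text \<open>The vector \<open>\<Sum>\<beta>\<in>X. f \<beta> *\<^sub>R \<beta>\<close> is fixed by the reflection in \<open>\<gamma>\<close>, hence orthogonal to \<open>\<gamma>\<close>.\<close>

lemma reflection_invariant_sum:
  assumes "\<gamma> \<in> R"
    and inv: "\<And>\<beta>. \<beta> \<in> X \<Longrightarrow> \<beta> - (\<beta> \<bullet> coroot \<gamma>) *\<^sub>R \<gamma> \<in> X \<and> f (\<beta> - (\<beta> \<bullet> coroot \<gamma>) *\<^sub>R \<gamma>) = f \<beta>"
  shows "(\<Sum>\<beta>\<in>X. f \<beta> * (\<beta> \<bullet> \<gamma>)) = 0"
proof -
  define s where "s \<beta> = \<beta> - (\<beta> \<bullet> coroot \<gamma>) *\<^sub>R \<gamma>" for \<beta>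
  have \<gamma>: "\<gamma> \<bullet> \<gamma> \<noteq> 0" "\<gamma> \<bullet> coroot \<gamma> = 2"
    using root_inner_pos[OF assms(1)] by (simp_all add: inner_coroot)
  have ss: "s (s \<beta>) = \<beta>" for \<beta>
    by (simp add: s_def inner_diff_left \<gamma> algebra_simps)
  have "(\<Sum>\<beta>\<in>X. f \<beta> * (\<beta> \<bullet> \<gamma>)) = (\<Sum>\<beta>\<in>X. f (s \<beta>) * (s \<beta> \<bullet> \<gamma>))"
    by (rule sum.reindex_bij_witness[of _ s s]) (use inv in \<open>simp_all add: ss s_def[symmetric]\<close>)
  also have "\<dots> = (\<Sum>\<beta>\<in>X. - (f \<beta> * (\<beta> \<bullet> \<gamma>)))"
  proof (rule sum.cong[OF refl])
    fix \<beta> assume "\<beta> \<in> X"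
    moreover have "s \<beta> \<bullet> \<gamma> = - (\<beta> \<bullet> \<gamma>)"
      using \<gamma> by (simp add: s_def inner_diff_left inner_coroot)
    ultimately show "f (s \<beta>) * (s \<beta> \<bullet> \<gamma>) = - (f \<beta> * (\<beta> \<bullet> \<gamma>))"
      using inv by (simp add: s_def[symmetric])
  qed
  finally show ?thesis
    by (simp add: sum_negf)
qed

text \<open>By reflection invariance each root is an eigenvector of the form. Symmetry makes the
  eigenvalues of non-orthogonal roots agree, so two different eigenvalues would split R
  orthogonally.\<close>

lemma root_form_scalar:
  "\<exists>C. \<forall>x y. (\<Sum>\<beta>\<in>R. (\<beta> \<bullet> x) * (\<beta> \<bullet> y)) = C * (x \<bullet> y)"
proof -
  define Q where "Q x y = (\<Sum>\<beta>\<in>R. (\<beta> \<bullet> x) * (\<beta> \<bullet> y))" for x y :: 'a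
  have Q_add: "Q (x + z) y = Q x y + Q z y" and Q_scale: "Q (c *\<^sub>R x) y = c * Q x y" for x y z c
    by (simp_all add: Q_def inner_add_right distrib_right sum.distrib sum_distrib_left mult.assoc)
  have Q_commute: "Q x y = Q y x" for x y
    by (simp add: Q_def mult.commute)
  define c where "c \<gamma> = Q \<gamma> \<gamma> / (\<gamma> \<bullet> \<gamma>)" for \<gamma>
  have eigen: "Q x \<gamma> = c \<gamma> * (x \<bullet> \<gamma>)" if \<gamma>: "\<gamma> \<in> R" for x \<gamma>
  proof -
    \<comment> \<open>The component of x orthogonal to \<gamma>. It is fixed by the reflection in
      \<gamma>, so the weights given by pairing with z are invariant.\<close>
    define z where "z = x - ((x \<bullet> \<gamma>) / (\<gamma> \<bullet> \<gamma>)) *\<^sub>R \<gamma>"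
    have pos: "\<gamma> \<bullet> \<gamma> \<noteq> 0"
      using root_inner_pos[OF \<gamma>] by simp
    have "z \<bullet> \<gamma> = 0"
      using pos by (simp add: z_def inner_diff_left)
    then have "Q z \<gamma> = 0"
      unfolding Q_def using reflection_root \<gamma>
      by (intro reflection_invariant_sum) (auto simp: inner_diff_left inner_commute[of \<gamma> z])
    moreover have "Q x \<gamma> = Q (((x \<bullet> \<gamma>) / (\<gamma> \<bullet> \<gamma>)) *\<^sub>R \<gamma> + z) \<gamma>"
      by (simp add: z_def)
    ultimately show ?thesis
      by (simp add: Q_add Q_scale c_def)
  qed
  have c_eq: "c \<beta> = c \<gamma>" if "\<beta> \<in> R" "\<gamma> \<in> R" "\<beta> \<bullet> \<gamma> \<noteq> 0" for \<beta> \<gamma>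
    using eigen[OF that(1), of \<gamma>] eigen[OF that(2), of \<beta>] that(3) Q_commute[of \<beta> \<gamma>]
    by (simp add: inner_commute)
  obtain \<gamma>0 where \<gamma>0: "\<gamma>0 \<in> R"
    using highest_root by blast
  define C where "C = c \<gamma>0"
  have "{\<beta> \<in> R. c \<beta> \<noteq> C} = {}"
  proof (rule ccontr)
    assume ne: "{\<beta> \<in> R. c \<beta> \<noteq> C} \<noteq> {}"
    have "R = {\<beta> \<in> R. c \<beta> = C} \<union> {\<beta> \<in> R. c \<beta> \<noteq> C}" "{\<beta> \<in> R. c \<beta> = C} \<noteq> {}"
      using \<gamma>0 by (auto simp: C_def)
    moreover have "\<forall>\<beta>\<in>{\<beta> \<in> R. c \<beta> = C}. \<forall>\<gamma>\<in>{\<beta> \<in> R. c \<beta> \<noteq> C}. \<beta> \<bullet> \<gamma> = 0"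
      using c_eq by fastforce
    ultimately show False
      using ne irreducible unfolding irreducible_roots_def by blast
  qed
  then have eq: "Q \<gamma> x = C * (\<gamma> \<bullet> x)" if "\<gamma> \<in> R" for x \<gamma>
    using eigen[OF that, of x] that Q_commute[of \<gamma> x] by (auto simp: inner_commute)
  have "Q y x = C * (y \<bullet> x)" for x y
  proof -
    have "y \<in> span R"
      using span_roots by simp
    then show ?thesis
      by (induction rule: span_induct_alt)
        (simp_all add: eq Q_add Q_scale inner_add_left algebra_simps, simp add: Q_def)
  qed
  then show ?thesis
    unfolding Q_def by blast
qed

text \<open>The sum of the positive roots is the vector known as 2 rho. A positive root other than
  \<gamma> is no multiple of \<gamma>, as R is reduced; so it has a positive coefficient elsewhere,
  which the reflection in \<gamma> leaves alone. The reflection thus permutes these roots, and only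
  \<gamma> contributes.\<close>

lemma sum_positive_roots_simple_coroot:
  assumes \<gamma>: "\<gamma> \<in> \<Delta>"
  shows "(\<Sum>\<beta>\<in>posroots. \<beta> \<bullet> coroot \<gamma>) = 2"
proof -
  have \<gamma>_root: "\<gamma> \<in> R" and \<gamma>_pos: "\<gamma> \<bullet> \<gamma> > 0"
    using simple_root[OF \<gamma>] root_inner_pos by auto
  have "(\<Sum>\<beta>\<in>posroots - {\<gamma>}. 1 * (\<beta> \<bullet> \<gamma>)) = 0"
  proof (rule reflection_invariant_sum[OF \<gamma>_root])
    fix \<beta> assume \<beta>: "\<beta> \<in> posroots - {\<gamma>}"
    have "\<exists>\<delta>\<in>\<Delta> - {\<gamma>}. \<beta> \<bullet> wt \<delta> > 0"
    proof (rule ccontr)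
      assume no: "\<not> (\<exists>\<delta>\<in>\<Delta> - {\<gamma>}. \<beta> \<bullet> wt \<delta> > 0)"
      have "\<beta> = (\<beta> \<bullet> wt \<gamma>) *\<^sub>R \<gamma>"
      proof (rule eq_if_coefficients_eq)
        fix \<delta> assume \<delta>: "\<delta> \<in> \<Delta>"
        have "\<beta> \<bullet> wt \<delta> = 0" if "\<delta> \<noteq> \<gamma>"
          using no \<delta> that \<beta> coefficient_nonneg[of \<beta> \<delta>] by force
        then show "\<beta> \<bullet> wt \<delta> = ((\<beta> \<bullet> wt \<gamma>) *\<^sub>R \<gamma>) \<bullet> wt \<delta>"
          using \<delta> \<gamma> by (simp add: inner_coweight)
      qed
      moreover from this have "(\<beta> \<bullet> wt \<gamma>) *\<^sub>R \<gamma> \<in> R"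
        using \<beta> by simp
      then have "\<beta> \<bullet> wt \<gamma> = 1 \<or> \<beta> \<bullet> wt \<gamma> = - 1"
        using reduced \<gamma>_root unfolding reduced_roots_def by blast
      ultimately show False
        using \<beta> \<gamma> coefficient_nonneg[of \<beta> \<gamma>] by auto
    qed
    then obtain \<delta> where \<delta>: "\<delta> \<in> \<Delta>" "\<delta> \<noteq> \<gamma>" "\<beta> \<bullet> wt \<delta> > 0"
      by auto
    define \<beta>' where "\<beta>' = \<beta> - (\<beta> \<bullet> coroot \<gamma>) *\<^sub>R \<gamma>"
    have "\<beta>' \<in> R"
      using \<beta> \<gamma>_root reflection_root by (simp add: \<beta>'_def)
    moreover have "\<beta>' \<bullet> wt \<delta> > 0"
      using \<delta> \<gamma> by (simp add: \<beta>'_def inner_diff_left inner_coweight)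
    ultimately have "ht \<beta>' > 0" "\<beta>' \<noteq> \<gamma>"
      using \<delta> \<gamma> ht_posI[of \<beta>' \<delta>] by (auto simp: inner_coweight)
    then show "\<beta> - (\<beta> \<bullet> coroot \<gamma>) *\<^sub>R \<gamma> \<in> posroots - {\<gamma>} \<and> (1 :: real) = 1"
      using \<open>\<beta>' \<in> R\<close> by (simp add: \<beta>'_def)
  qed
  then have "(\<Sum>\<beta>\<in>posroots. \<beta> \<bullet> \<gamma>) = \<gamma> \<bullet> \<gamma>"
    using sum.remove[of posroots \<gamma> "\<lambda>\<beta>. \<beta> \<bullet> \<gamma>"] finite_roots \<gamma> \<gamma>_root by (simp add: ht_simple)
  moreover have "(\<Sum>\<beta>\<in>posroots. \<beta> \<bullet> coroot \<gamma>) = 2 / (\<gamma> \<bullet> \<gamma>) * (\<Sum>\<beta>\<in>posroots. \<beta> \<bullet> \<gamma>)"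
    by (simp add: inner_coroot sum_distrib_left)
  ultimately show ?thesis
    using \<gamma>_pos by simp
qed

section \<open>Simple coroots, fundamental weights and the dual Coxeter number\<close>

lemma coroot_simple_scaled: "\<gamma> \<in> \<Delta> \<Longrightarrow> ((\<gamma> \<bullet> \<gamma>) / 2) *\<^sub>R coroot \<gamma> = \<gamma>"
  using root_inner_pos[OF simple_root, of \<gamma>] by (simp add: coroot_def)

lemma coroot_inner_coweight:
  assumes "\<gamma> \<in> \<Delta>" "\<delta> \<in> \<Delta>"
  shows "coroot \<gamma> \<bullet> wt \<delta> = (if \<gamma> = \<delta> then 2 / (\<gamma> \<bullet> \<gamma>) else 0)"
  using assms by (simp add: coroot_def inner_coweight)

lemma inj_coroot_simple: "inj_on coroot \<Delta>"
proof (rule inj_onI)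
  fix \<gamma> \<delta> assume *: "\<gamma> \<in> \<Delta>" "\<delta> \<in> \<Delta>" "coroot \<gamma> = coroot \<delta>"
  then have "coroot \<gamma> \<bullet> wt \<gamma> = coroot \<delta> \<bullet> wt \<gamma>"
    by simp
  then show "\<gamma> = \<delta>"
    using *(1,2) root_inner_pos[OF simple_root[OF *(1)]]
    by (auto simp: coroot_inner_coweight split: if_splits)
qed

lemma span_coroot_simple: "span (coroot ` \<Delta>) = UNIV"
proof -
  have "\<gamma> \<in> span (coroot ` \<Delta>)" if "\<gamma> \<in> \<Delta>" for \<gamma>
  proof -
    have "((\<gamma> \<bullet> \<gamma>) / 2) *\<^sub>R coroot \<gamma> \<in> span (coroot ` \<Delta>)"
      using that by (simp add: span_scale span_base)
    then show ?thesis
      using coroot_simple_scaled[OF that] by simp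
  qed
  then have "span \<Delta> \<subseteq> span (coroot ` \<Delta>)"
    by (intro span_minimal) auto
  then show ?thesis
    using span_simple by auto
qed

lemma independent_coroot_simple: "independent (coroot ` \<Delta>)"
proof (rule card_le_dim_spanning[of _ UNIV])
  have "span \<Delta> = span UNIV"
    by (simp add: span_simple)
  then show "card (coroot ` \<Delta>) \<le> dim (UNIV :: 'a set)"
    using card_image[OF inj_coroot_simple] dim_eq_card[OF _ independent_simple, of UNIV] by simp
qed (use span_coroot_simple finite_simple in auto)

lemma fund_weight_eq:
  assumes "\<alpha> \<in> \<Delta>"
  shows "fund_weight \<Delta> \<alpha> = ((\<alpha> \<bullet> \<alpha>) / 2) *\<^sub>R wt \<alpha>"
  unfolding fund_weight_def
proof (rule the_equality)
  show *: "\<forall>\<beta>\<in>\<Delta>. ((\<alpha> \<bullet> \<alpha>) / 2) *\<^sub>R wt \<alpha> \<bullet> coroot \<beta> = (if \<beta> = \<alpha> then 1 else 0)"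
    using assms root_inner_pos[OF simple_root[OF assms]]
    by (auto simp: inner_commute[of "wt \<alpha>"] coroot_inner_coweight)
  fix w assume w: "\<forall>\<beta>\<in>\<Delta>. w \<bullet> coroot \<beta> = (if \<beta> = \<alpha> then 1 else 0)"
  show "w = ((\<alpha> \<bullet> \<alpha>) / 2) *\<^sub>R wt \<alpha>"
    using * w by (intro eq_if_inner_eq_on_spanning[OF span_coroot_simple]) (auto simp: inner_commute)
qed

lemma h_coeff_eq: "\<alpha> \<in> \<Delta> \<Longrightarrow> h_coeff R \<Delta> \<alpha> = \<theta> \<bullet> wt \<alpha>"
  by (simp add: h_coeff_def representation_simple)

text \<open>Passing to coroots rescales each simple root by its own length. The quotient of the
  coefficients h and g at \<alpha> is therefore a ratio of squared root lengths.\<close>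

lemma g_coeff_eq:
  assumes "\<alpha> \<in> \<Delta>"
  shows "g_coeff R \<Delta> \<alpha> = (\<alpha> \<bullet> \<alpha>) / (\<theta> \<bullet> \<theta>) * (\<theta> \<bullet> wt \<alpha>)"
proof -
  have "g_coeff R \<Delta> \<alpha> = coroot \<theta> \<bullet> (((\<alpha> \<bullet> \<alpha>) / 2) *\<^sub>R wt \<alpha>)"
    unfolding g_coeff_def
  proof (rule representation_eq_inner[OF independent_coroot_simple])
    fix b assume "b \<in> coroot ` \<Delta>"
    then obtain \<gamma> where \<gamma>: "\<gamma> \<in> \<Delta>" "b = coroot \<gamma>"
      by auto
    then show "b \<bullet> (((\<alpha> \<bullet> \<alpha>) / 2) *\<^sub>R wt \<alpha>) = of_bool (b = coroot \<alpha>)"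
      using assms root_inner_pos[OF simple_root[OF assms]] inj_on_eq_iff[OF inj_coroot_simple]
      by (simp add: coroot_inner_coweight)
  qed (use assms span_coroot_simple in auto)
  then show ?thesis
    by (simp add: coroot_def)
qed

lemma coroot_highest_root: "coroot \<theta> = (\<Sum>\<gamma>\<in>\<Delta>. g_coeff R \<Delta> \<gamma> *\<^sub>R coroot \<gamma>)"
proof -
  have "coroot \<theta> = (2 / (\<theta> \<bullet> \<theta>)) *\<^sub>R (\<Sum>\<gamma>\<in>\<Delta>. (\<theta> \<bullet> wt \<gamma>) *\<^sub>R \<gamma>)"
    by (simp add: simple_expansion coroot_def)
  also have "\<dots> = (\<Sum>\<gamma>\<in>\<Delta>. g_coeff R \<Delta> \<gamma> *\<^sub>R coroot \<gamma>)"
    unfolding scaleR_sum_right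
  proof (rule sum.cong[OF refl])
    fix \<gamma> assume "\<gamma> \<in> \<Delta>"
    then show "(2 / (\<theta> \<bullet> \<theta>)) *\<^sub>R (\<theta> \<bullet> wt \<gamma>) *\<^sub>R \<gamma> = g_coeff R \<Delta> \<gamma> *\<^sub>R coroot \<gamma>"
      using root_inner_pos[OF simple_root, of \<gamma>] by (simp add: g_coeff_eq coroot_def)
  qed
  finally show ?thesis .
qed

text \<open>Let n be the pairing. The negative of the reflection of \<beta> in \<theta> is the root
  n\<theta> - \<beta>, whose coefficients are bounded by those of \<theta>. For n at least 2 this
  makes those of \<beta> at least those of \<theta>, hence equal.\<close>

lemma inner_coroot_highest_root:
  assumes "\<beta> \<in> R" "ht \<beta> > 0" "\<beta> \<noteq> \<theta>"
  shows "\<beta> \<bullet> coroot \<theta> = 0 \<or> \<beta> \<bullet> coroot \<theta> = 1"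
proof -
  obtain n where n: "\<beta> \<bullet> coroot \<theta> = of_int n"
    using coroot_integral[OF highest_root assms(1)] by (auto elim: Ints_cases)
  have "\<beta> \<bullet> coroot \<theta> \<ge> 0"
    using highest_root_inner_nonneg[OF assms(1,2)] by (simp add: inner_coroot)
  moreover have "n < 2"
  proof (rule ccontr)
    assume "\<not> n < 2"
    have refl: "- (\<beta> - of_int n *\<^sub>R \<theta>) \<in> R"
      using uminus_root[OF reflection_root[OF highest_root assms(1)]] unfolding n .
    have "\<beta> \<bullet> wt \<gamma> = \<theta> \<bullet> wt \<gamma>" if \<gamma>: "\<gamma> \<in> \<Delta>" for \<gamma>
    proof -
      have "of_int n * (\<theta> \<bullet> wt \<gamma>) - \<beta> \<bullet> wt \<gamma> \<le> \<theta> \<bullet> wt \<gamma>"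
        using coefficient_le_highest_root[OF refl \<gamma>] by (simp add: inner_diff_left)
      moreover have "2 * (\<theta> \<bullet> wt \<gamma>) \<le> of_int n * (\<theta> \<bullet> wt \<gamma>)"
        using \<open>\<not> n < 2\<close> highest_root_coefficient_ge_1[OF \<gamma>] by (intro mult_right_mono) auto
      ultimately show ?thesis
        using coefficient_le_highest_root[OF assms(1) \<gamma>] by linarith
    qed
    then show False
      using assms(3) eq_if_coefficients_eq by blast
  qed
  ultimately have "n = 0 \<or> n = 1"
    using n by auto
  then show ?thesis
    using n by auto
qed

text \<open>The constant is found by setting both arguments to \<open>coroot \<theta>\<close>, where
  the squares become linear. The linear sum is the pairing of 2 rho with
  \<open>coroot \<theta>\<close>, that is 2(g - 1). The form then takes the value 4g, and
  \<open>coroot \<theta>\<close> has squared length 4 over that of \<theta>.\<close>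

lemma root_form_dual_coxeter:
  "(\<Sum>\<beta>\<in>R. (\<beta> \<bullet> x) * (\<beta> \<bullet> y)) = dual_coxeter_number R \<Delta> * (\<theta> \<bullet> \<theta>) * (x \<bullet> y)"
proof -
  obtain C where C: "\<And>x y. (\<Sum>\<beta>\<in>R. (\<beta> \<bullet> x) * (\<beta> \<bullet> y)) = C * (x \<bullet> y)"
    using root_form_scalar by blast
  have \<theta>_pos: "\<theta> \<bullet> \<theta> > 0"
    using highest_root root_inner_pos by blast
  have "\<Delta> \<noteq> {}"
    using \<theta>_pos inner_expansion[of \<theta> \<theta>] by auto
  then obtain \<delta> where \<delta>: "\<delta> \<in> \<Delta>"
    by blast
  have \<theta>_mem: "\<theta> \<in> posroots"
    using highest_root ht_posI[OF highest_root \<delta>] highest_root_coefficient_ge_1[OF \<delta>] by simp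
  have "(\<Sum>\<beta>\<in>R. (\<beta> \<bullet> coroot \<theta>)\<^sup>2) = 2 * (\<Sum>\<beta>\<in>posroots. (\<beta> \<bullet> coroot \<theta>)\<^sup>2)"
    using ht_nonzero by (intro sum_even_roots) (auto simp: ht_minus)
  \<comment> \<open>The pairing is 0 or 1, hence equal to its square, except at \<theta> itself,
    where it is 2 and the square exceeds it by 2.\<close>
  also have "(\<Sum>\<beta>\<in>posroots. (\<beta> \<bullet> coroot \<theta>)\<^sup>2) =
      (\<Sum>\<beta>\<in>posroots. \<beta> \<bullet> coroot \<theta> + 2 * of_bool (\<beta> = \<theta>))"
  proof (rule sum.cong[OF refl])
    fix \<beta> assume "\<beta> \<in> posroots"
    then show "(\<beta> \<bullet> coroot \<theta>)\<^sup>2 = \<beta> \<bullet> coroot \<theta> + 2 * of_bool (\<beta> = \<theta>)"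
      using inner_coroot_highest_root[of \<beta>] \<theta>_pos
      by (cases "\<beta> = \<theta>") (auto simp: inner_coroot power2_eq_square)
  qed
  also have "\<dots> = (\<Sum>\<beta>\<in>posroots. \<beta> \<bullet> coroot \<theta>) + 2"
    using \<theta>_mem finite_roots by (simp add: sum.distrib flip: sum_distrib_left)
  also have "(\<Sum>\<beta>\<in>posroots. \<beta> \<bullet> coroot \<theta>) =
      (\<Sum>\<gamma>\<in>\<Delta>. g_coeff R \<Delta> \<gamma> * (\<Sum>\<beta>\<in>posroots. \<beta> \<bullet> coroot \<gamma>))"
    unfolding coroot_highest_root inner_sum_right sum_distrib_left
    by (subst sum.swap) simp
  also have "\<dots> = 2 * (dual_coxeter_number R \<Delta> - 1)"
    by (simp add: sum_positive_roots_simple_coroot dual_coxeter_number_def sum_distrib_left mult.commute)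
  finally have "C * (coroot \<theta> \<bullet> coroot \<theta>) = 4 * dual_coxeter_number R \<Delta>"
    by (simp add: C power2_eq_square)
  then have "C = dual_coxeter_number R \<Delta> * (\<theta> \<bullet> \<theta>)"
    using \<theta>_pos by (simp add: coroot_def field_simps)
  then show ?thesis
    by (simp add: C)
qed

section \<open>Levels of the roots at a fixed simple root\<close>

context
  fixes \<alpha> :: 'a
  assumes \<alpha>: "\<alpha> \<in> \<Delta>"
begin

abbreviation level :: "'a \<Rightarrow> real"
  where "level \<beta> \<equiv> \<beta> \<bullet> wt \<alpha>"

abbreviation N :: nat
  where "N \<equiv> nat \<lfloor>h_coeff R \<Delta> \<alpha>\<rfloor>"

lemma real_N: "real N = level \<theta>"
proof -
  obtain n where "level \<theta> = of_int n"
    using coefficient_integral[OF highest_root \<alpha>] by (auto elim: Ints_cases)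
  then show ?thesis
    using highest_root_coefficient_ge_1[OF \<alpha>] by (simp add: h_coeff_eq \<alpha>)
qed

lemma positive_level:
  assumes "\<beta> \<in> R" "0 < level \<beta>"
  shows "nat \<lfloor>level \<beta>\<rfloor> \<in> {1..N}" "real (nat \<lfloor>level \<beta>\<rfloor>) = level \<beta>"
proof -
  obtain n where n: "level \<beta> = of_int n"
    using coefficient_integral[OF assms(1) \<alpha>] by (auto elim: Ints_cases)
  then show eq: "real (nat \<lfloor>level \<beta>\<rfloor>) = level \<beta>"
    using assms(2) by simp
  then have "real (nat \<lfloor>level \<beta>\<rfloor>) \<le> real N"
    using coefficient_le_highest_root[OF assms(1) \<alpha>] real_N by linarith
  then show "nat \<lfloor>level \<beta>\<rfloor> \<in> {1..N}"
    using n assms(2) by (simp add: Suc_le_eq)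
qed

lemma wt_pos: "0 < wt \<alpha> \<bullet> wt \<alpha>"
proof -
  have "wt \<alpha> \<noteq> 0"
    using inner_coweight[OF \<alpha> \<alpha>] by auto
  then show ?thesis
    by simp
qed

lemma fund_weight_inner_coweight: "fund_weight \<Delta> \<alpha> \<bullet> wt \<alpha> = (\<alpha> \<bullet> \<alpha>) / 2 * (wt \<alpha> \<bullet> wt \<alpha>)"
  by (simp add: fund_weight_eq \<alpha>)

lemma fund_weight_inner_coweight_pos: "0 < fund_weight \<Delta> \<alpha> \<bullet> wt \<alpha>"
  unfolding fund_weight_inner_coweight
  using wt_pos root_inner_pos[OF simple_root[OF \<alpha>]] by (intro mult_pos_pos) auto

lemma sum_c_count:
  "(\<Sum>m=1..N. real (c_count R \<Delta> \<alpha> m) * f (real m)) = (\<Sum>\<beta> | \<beta> \<in> R \<and> 0 < level \<beta>. f (level \<beta>))"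
proof -
  have "(\<Sum>\<beta> | \<beta> \<in> R \<and> 0 < level \<beta>. f (level \<beta>)) =
      (\<Sum>m=1..N. \<Sum>\<beta> | \<beta> \<in> {\<beta>. \<beta> \<in> R \<and> 0 < level \<beta>} \<and> nat \<lfloor>level \<beta>\<rfloor> = m. f (level \<beta>))"
    using finite_roots positive_level(1) by (intro sum.group[symmetric]) auto
  also have "\<dots> = (\<Sum>m=1..N. real (c_count R \<Delta> \<alpha> m) * f (real m))"
  proof (rule sum.cong[OF refl])
    fix m assume m: "m \<in> {1..N}"
    have "{\<beta>. \<beta> \<in> {\<beta>. \<beta> \<in> R \<and> 0 < level \<beta>} \<and> nat \<lfloor>level \<beta>\<rfloor> = m} = {\<beta> \<in> R. level \<beta> = real m}"
      using m positive_level(2) by force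
    then show "(\<Sum>\<beta> | \<beta> \<in> {\<beta>. \<beta> \<in> R \<and> 0 < level \<beta>} \<and> nat \<lfloor>level \<beta>\<rfloor> = m. f (level \<beta>)) =
        real (c_count R \<Delta> \<alpha> m) * f (real m)"
      by (simp add: c_count_def)
  qed
  finally show ?thesis ..
qed

text \<open>Regroups by level for arbitrary f: the identity function leads to the value of M, and
  \<open>saw\<close> to the vanishing sums.\<close>

lemma sum_i_num:
  "(\<Sum>m=1..N. i_num R \<Delta> \<alpha> m * f (real m)) =
    (\<Sum>\<beta> | \<beta> \<in> R \<and> 0 < level \<beta>. level \<beta> * f (level \<beta>)) / (fund_weight \<Delta> \<alpha> \<bullet> wt \<alpha>)"
  unfolding sum_c_count[of "\<lambda>z. z * f z", symmetric] sum_divide_distrib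
  by (intro sum.cong refl) (simp add: i_num_def)

lemma i_num_pos:
  assumes "m \<in> {1..N}"
  shows "i_num R \<Delta> \<alpha> m > 0"
proof -
  have "1 \<le> m" "real m \<le> level \<theta>"
    using assms real_N by auto
  then obtain \<beta> where "\<beta> \<in> R" "level \<beta> = real m"
    by (rule root_of_level[OF \<alpha>])
  then have "c_count R \<Delta> \<alpha> m > 0"
    unfolding c_count_def using finite_roots by (subst card_gt_0_iff) auto
  then show ?thesis
    using assms fund_weight_inner_coweight_pos by (simp add: i_num_def)
qed

lemma i_num_eq_0: "m > N \<Longrightarrow> i_num R \<Delta> \<alpha> m = 0"
proof -
  assume "m > N"
  then have "{\<beta> \<in> R. level \<beta> = real m} = {}"
    using coefficient_le_highest_root[OF _ \<alpha>] real_N by force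
  then have "c_count R \<Delta> \<alpha> m = 0"
    unfolding c_count_def by (simp only: card.empty)
  then show ?thesis
    by (simp add: i_num_def)
qed

text \<open>The roots of level \<open>m\<close> sum to a vector orthogonal to the other simple roots, that is, to a
  multiple of the fundamental weight; the multiple is the pairing of this sum with \<open>coroot \<alpha>\<close>.\<close>

lemma i_num_integral: "i_num R \<Delta> \<alpha> m \<in> \<int>"
proof -
  define X where "X = {\<beta> \<in> R. level \<beta> = real m}"
  define u where "u = \<Sum>X"
  have orth: "\<gamma> \<bullet> u = 0" if \<gamma>: "\<gamma> \<in> \<Delta>" "\<gamma> \<noteq> \<alpha>" for \<gamma>
  proof -
    have "(\<Sum>\<beta>\<in>X. 1 * (\<beta> \<bullet> \<gamma>)) = 0"
      using reflection_root \<gamma> \<alpha> simple_root[OF \<gamma>(1)]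
      by (intro reflection_invariant_sum) (auto simp: X_def inner_diff_left inner_coweight)
    then show ?thesis
      by (simp add: u_def inner_sum_right inner_commute)
  qed
  \<comment> \<open>The pairing of u with the coweight is computed twice: root by root it is m
    c(\<alpha>, m), and by expanding the coweight in simple roots only the term at \<alpha>
    survives. Comparison gives \<open>i_num\<close> as a pairing with
    \<open>coroot \<alpha>\<close>.\<close>
  have "wt \<alpha> \<bullet> u = (\<Sum>\<gamma>\<in>\<Delta>. if \<gamma> = \<alpha> then (wt \<alpha> \<bullet> wt \<alpha>) * (\<alpha> \<bullet> u) else 0)"
    unfolding inner_expansion[of "wt \<alpha>" u] by (intro sum.cong) (auto simp: orth)
  then have "wt \<alpha> \<bullet> u = (wt \<alpha> \<bullet> wt \<alpha>) * (\<alpha> \<bullet> u)"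
    using \<alpha> finite_simple by simp
  also have "\<dots> = (fund_weight \<Delta> \<alpha> \<bullet> wt \<alpha>) * (u \<bullet> coroot \<alpha>)"
    using root_inner_pos[OF simple_root[OF \<alpha>]]
    by (simp add: fund_weight_inner_coweight inner_coroot inner_commute[of u])
  also have "wt \<alpha> \<bullet> u = real m * real (c_count R \<Delta> \<alpha> m)"
    by (simp add: u_def X_def inner_sum_right inner_commute[of "wt \<alpha>"] c_count_def)
  finally have "i_num R \<Delta> \<alpha> m = u \<bullet> coroot \<alpha>"
    using fund_weight_inner_coweight_pos by (simp add: i_num_def)
  also have "\<dots> \<in> \<int>"
    unfolding u_def inner_sum_left
    using coroot_integral[OF simple_root[OF \<alpha>]] by (intro Ints_sum) (auto simp: X_def)
  finally show ?thesis .
qed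

lemma d_num_eq_sum:
  assumes "k \<in> {1..N}"
  shows "d_num R \<Delta> \<alpha> k = (\<Sum>m=1..N. if k dvd m then i_num R \<Delta> \<alpha> m else 0)"
proof -
  have "{l. 1 \<le> l \<and> l * k \<le> N} \<subseteq> {..N}"
  proof
    fix l assume "l \<in> {l. 1 \<le> l \<and> l * k \<le> N}"
    then have "l * k \<le> N"
      by simp
    moreover have "l \<le> l * k"
      using assms by simp
    ultimately show "l \<in> {..N}"
      unfolding atMost_iff by (rule le_trans[rotated])
  qed
  then have fin: "finite {l. 1 \<le> l \<and> l * k \<le> N}"
    by (rule finite_subset) simp
  have "d_num R \<Delta> \<alpha> k = infsum (\<lambda>l. i_num R \<Delta> \<alpha> (l * k)) {l. 1 \<le> l \<and> l * k \<le> N}"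
    unfolding d_num_def by (rule infsum_cong_neutral) (auto intro: i_num_eq_0)
  also have "\<dots> = (\<Sum>l | 1 \<le> l \<and> l * k \<le> N. i_num R \<Delta> \<alpha> (l * k))"
    using fin by (rule infsum_finite)
  also have "\<dots> = (\<Sum>m | m \<in> {1..N} \<and> k dvd m. i_num R \<Delta> \<alpha> m)"
    using assms by (intro sum.reindex_bij_witness[of _ "\<lambda>m. m div k" "\<lambda>l. l * k"])
      (auto simp: Suc_le_eq elim!: dvdE)
  also have "\<dots> = (\<Sum>m=1..N. if k dvd m then i_num R \<Delta> \<alpha> m else 0)"
    by (rule sum.inter_filter) simp
  finally show ?thesis .
qed

lemma sum_i_num_saw:
  assumes "x \<in> {1..N}"
  shows "(\<Sum>m=1..N. i_num R \<Delta> \<alpha> m * saw (real m * (of_int a / real x))) = 0"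
proof -
  define t where "t = real_of_int a / real x"
  define \<xi> where "\<xi> = (\<Sum>\<beta>\<in>R. saw (level \<beta> * t) *\<^sub>R \<beta>)"
  have orth: "\<gamma> \<bullet> \<xi> = 0" if \<gamma>: "\<gamma> \<in> R" and int: "level \<gamma> * t \<in> \<int>" for \<gamma>
  proof -
    have "(\<Sum>\<beta>\<in>R. saw (level \<beta> * t) * (\<beta> \<bullet> \<gamma>)) = 0"
    proof (rule reflection_invariant_sum[OF \<gamma>])
      fix \<beta> assume \<beta>: "\<beta> \<in> R"
      have "level (\<beta> - (\<beta> \<bullet> coroot \<gamma>) *\<^sub>R \<gamma>) * t = level \<beta> * t - (\<beta> \<bullet> coroot \<gamma>) * (level \<gamma> * t)"
        by (simp add: inner_diff_left algebra_simps)
      moreover have "(\<beta> \<bullet> coroot \<gamma>) * (level \<gamma> * t) \<in> \<int>"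
        using coroot_integral[OF \<gamma> \<beta>] int by (rule Ints_mult)
      ultimately show "\<beta> - (\<beta> \<bullet> coroot \<gamma>) *\<^sub>R \<gamma> \<in> R \<and>
          saw (level (\<beta> - (\<beta> \<bullet> coroot \<gamma>) *\<^sub>R \<gamma>) * t) = saw (level \<beta> * t)"
        using reflection_root[OF \<gamma> \<beta>] by (simp only: saw_diff_int)
    qed
    then show ?thesis
      by (simp add: \<xi>_def inner_sum_right inner_commute)
  qed
  have orth_simple: "\<gamma> \<bullet> \<xi> = 0" if "\<gamma> \<in> \<Delta>" "\<gamma> \<noteq> \<alpha>" for \<gamma>
    using that simple_root \<alpha> by (intro orth) (auto simp: inner_coweight)
  \<comment> \<open>Orthogonality to the other simple roots leaves one unknown, the pairing of \<xi>
    with \<alpha>. Any root of nonzero level orthogonal to \<xi> makes it 0; the root \<eta> of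
    level x qualifies since \<open>level \<eta> * t\<close> is the integer a.\<close>
  have expand: "z \<bullet> \<xi> = level z * (\<alpha> \<bullet> \<xi>)" for z
  proof -
    have "z \<bullet> \<xi> = (\<Sum>\<gamma>\<in>\<Delta>. if \<gamma> = \<alpha> then level z * (\<alpha> \<bullet> \<xi>) else 0)"
      unfolding inner_expansion[of z \<xi>] by (intro sum.cong) (auto simp: orth_simple)
    then show ?thesis
      using \<alpha> finite_simple by simp
  qed
  have "1 \<le> x" "real x \<le> level \<theta>"
    using assms real_N by auto
  then obtain \<eta> where \<eta>: "\<eta> \<in> R" "level \<eta> = real x"
    by (rule root_of_level[OF \<alpha>])
  have "\<eta> \<bullet> \<xi> = 0"
    using \<eta> assms by (intro orth) (auto simp: t_def)
  then have "\<alpha> \<bullet> \<xi> = 0"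
    using expand[of \<eta>] \<eta> assms by simp
  then have "wt \<alpha> \<bullet> \<xi> = 0"
    using expand[of "wt \<alpha>"] by simp
  then have "0 = (\<Sum>\<beta>\<in>R. level \<beta> * saw (level \<beta> * t))"
    by (simp add: \<xi>_def inner_sum_right inner_commute[of "wt \<alpha>"] mult.commute)
  also have "\<dots> = 2 * (\<Sum>\<beta> | \<beta> \<in> R \<and> 0 < level \<beta>. level \<beta> * saw (level \<beta> * t))"
    by (intro sum_even_roots) (auto simp: saw_minus)
  finally have "(\<Sum>\<beta> | \<beta> \<in> R \<and> 0 < level \<beta>. level \<beta> * saw (level \<beta> * t)) = 0"
    by simp
  then show ?thesis
    unfolding t_def[symmetric] sum_i_num[of "\<lambda>z. saw (z * t)"] by simp
qed

text \<open>This is the invariant form with both arguments \<open>wt \<alpha>\<close>, halved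
  because only positive levels are summed. The squared length of the coweight cancels against the
  normalization of \<open>i_num\<close>.\<close>

lemma sum_mult_i_num:
  "(\<Sum>m=1..N. real m * i_num R \<Delta> \<alpha> m) =
    dual_coxeter_number R \<Delta> * h_coeff R \<Delta> \<alpha> / g_coeff R \<Delta> \<alpha>"
proof -
  have pos: "\<alpha> \<bullet> \<alpha> > 0" "\<theta> \<bullet> \<theta> > 0" "level \<theta> > 0"
    using root_inner_pos[OF simple_root[OF \<alpha>]] root_inner_pos[OF highest_root]
      highest_root_coefficient_ge_1[OF \<alpha>] by auto
  have "(\<Sum>\<beta>\<in>R. level \<beta> * level \<beta>) = 2 * (\<Sum>\<beta> | \<beta> \<in> R \<and> 0 < level \<beta>. level \<beta> * level \<beta>)"
    by (intro sum_even_roots) auto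
  then have "(\<Sum>\<beta> | \<beta> \<in> R \<and> 0 < level \<beta>. level \<beta> * level \<beta>) =
      dual_coxeter_number R \<Delta> * (\<theta> \<bullet> \<theta>) * (wt \<alpha> \<bullet> wt \<alpha>) / 2"
    by (simp add: root_form_dual_coxeter)
  then have "(\<Sum>m=1..N. i_num R \<Delta> \<alpha> m * real m) = dual_coxeter_number R \<Delta> * (\<theta> \<bullet> \<theta>) / (\<alpha> \<bullet> \<alpha>)"
    using wt_pos pos unfolding sum_i_num[of "\<lambda>z. z"] fund_weight_inner_coweight by (simp add: field_simps)
  also have "\<dots> = dual_coxeter_number R \<Delta> * h_coeff R \<Delta> \<alpha> / g_coeff R \<Delta> \<alpha>"
    using pos by (simp add: h_coeff_eq g_coeff_eq \<alpha> field_simps)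
  finally show ?thesis
    by (simp add: mult.commute)
qed

lemma circular_symmetry_d_num:
  "circular_symmetry N (dual_coxeter_number R \<Delta> * h_coeff R \<Delta> \<alpha> / g_coeff R \<Delta> \<alpha>) (d_num R \<Delta> \<alpha>)"
  by (rule circular_symmetryI[OF i_num_integral i_num_pos d_num_eq_sum sum_mult_i_num[symmetric] sum_i_num_saw])

end

end

(* h_coeff is a real number by type and a positive integer in value, so the floor is exact. *)
theorem proposition1p4p17:
  fixes R \<Delta> :: "'a::euclidean_space set" and \<alpha> :: 'a
  assumes "root_system R" and "reduced_roots R" and "irreducible_roots R"
    and "simple_roots R \<Delta>" and "\<alpha> \<in> \<Delta>"
  shows "circular_symmetry (nat \<lfloor>h_coeff R \<Delta> \<alpha>\<rfloor>)
    (dual_coxeter_number R \<Delta> * h_coeff R \<Delta> \<alpha> / g_coeff R \<Delta> \<alpha>)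
    (d_num R \<Delta> \<alpha>)"
proof -
  interpret irreducible_root_basis R \<Delta>
    using assms(1-4) by unfold_locales
  show ?thesis
    using assms(5) by (rule circular_symmetry_d_num)
qed

end
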